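(* Let $\mathbf{P}$ be a prevariety that is residually small (i.e., that can be generated as a prevariety by a set of algebras), and let $\kappa$ be a cardinal. Consider the conditions: (1) $\mathbf{P}$ can be generated, as a prevariety, by a set of $\leq\kappa$ algebras. (2) Every set $\mathbf{X}$ of subdirectly irreducible algebras in $\mathbf{P}$ can be written as the union of $\leq\kappa$ subsets $\mathbf{X}_\alpha$ $(\alpha\in\kappa)$, each of which is $\mathbf{P}$-compatible. Then (1) implies (2); and if $\mathbf{P}$ is a quasivariety, (1) and (2) are equivalent.
   Context: Algebras may have operations of infinite arity unless stated to be finitary; the empty algebra is admitted when there are no zeroary operations. For a class $\mathbf{X}$ of algebras of the same type, $\mathbb{S}\,\mathbf{X}$ is the class of algebras isomorphic to subalgebras of members of $\mathbf{X}$, and $\mathbb{P}\,\mathbf{X}$ the class of algebras isomorphic to direct products of (possibly empty) families of members of $\mathbf{X}$. A prevariety is a class of algebras of a given type closed under $\mathbb{S}$ and $\mathbb{P}$; the prevariety generated by $\mathbf{X}$ is $\mathbb{S}\,\mathbb{P}\,\mathbf{X}$. A quasivariety is a prevariety of finitary algebras (all primitive operations of finite arity) that is closed under ultraproducts; equivalently, that is definable by conditions $(\forall x\in A^I)\ (\bigwedge_{j\in J}a_j(x)=b_j(x))\Rightarrow c(x)=d(x)$ with $I,J$ finite and $a_j,b_j,c,d$ terms. A subdirect product of a (possibly empty) family $(B_i)_{i\in I}$ is a subalgebra of $\prod_I B_i$ which projects surjectively to each $B_i$. An algebra in $\mathbf{P}$ is subdirectly irreducible (in $\mathbf{P}$)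 if it cannot be expressed, up to isomorphism, as a subdirect product of a family of algebras in $\mathbf{P}$ without one of the projection maps being an isomorphism. A set $\mathbf{X}$ of algebras in $\mathbf{P}$ is called $\mathbf{P}$-compatible if for every $A_0\in\mathbf{X}$ the coprojection map from $A_0$ to the coproduct in $\mathbf{P}$ of all $A\in\mathbf{X}$ is one-to-one; equivalently, if there exists an algebra $B$ in $\mathbf{P}$ admitting one-to-one homomorphisms $A\to B$ for all $A\in\mathbf{X}$. *)

theory Defs
  imports Main "HOL-Library.FuncSet"
begin

unbundle cardinal_syntax

text \<open>
  The distinction between sets and proper classes is made relative to a type \<open>'u\<close> playing the role
  of a Grothendieck universe: its cardinality is a regular strong limit, the collections of smaller
  cardinality are the sets, and arbitrary collections are the classes. Every set is equipotent to a
  small subset of \<open>'u\<close>, so up to isomorphism every algebra has its carrier, and every family its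
  index set, inside \<open>'u\<close>. Uncountability is not required; \<open>'u\<close> countable is the degenerate case
  in which the sets are the finite ones.
\<close>

definition universe :: "'u itself \<Rightarrow> bool" where
  "universe U \<longleftrightarrow>
     infinite (UNIV :: 'u set) \<and>
     regularCard |UNIV :: 'u set| \<and>
     (\<forall>S :: 'u set. |S| <o |UNIV :: 'u set| \<longrightarrow> |Pow S| <o |UNIV :: 'u set| )"

definition small :: "'u itself \<Rightarrow> 'x set \<Rightarrow> bool" where
  "small U S \<longleftrightarrow> |S| <o |UNIV :: 'u set|"

record ('f, 'r) signature =
  ops :: "'f set"
  arity :: "'f \<Rightarrow> 'r set"

record ('f, 'r, 'a) algebra =
  carrier :: "'a set"
  oper :: "'f \<Rightarrow> ('r \<Rightarrow> 'a) \<Rightarrow> 'a"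

definition small_signature :: "'u itself \<Rightarrow> ('f, 'r) signature \<Rightarrow> bool" where
  "small_signature U \<Omega> \<longleftrightarrow> small U (ops \<Omega>) \<and> (\<forall>f\<in>ops \<Omega>. small U (arity \<Omega> f))"

definition finitary :: "('f, 'r) signature \<Rightarrow> bool" where
  "finitary \<Omega> \<longleftrightarrow> (\<forall>f\<in>ops \<Omega>. finite (arity \<Omega> f))"

text \<open>
  Operations are extensional, so that equality of records is equality of algebras. A zeroary
  operation has the one-element domain \<open>{} \<rightarrow>\<^sub>E carrier A\<close>; hence \<open>carrier A = {}\<close> is admitted
  exactly when there are no zeroary operations.
\<close>

definition is_algebra :: "('f, 'r) signature \<Rightarrow> ('f, 'r, 'a) algebra \<Rightarrow> bool" where
  "is_algebra \<Omega> A \<longleftrightarrow>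
     oper A \<in> (\<Pi>\<^sub>E f\<in>ops \<Omega>. (arity \<Omega> f \<rightarrow>\<^sub>E carrier A) \<rightarrow>\<^sub>E carrier A)"

definition Alg :: "('f, 'r) signature \<Rightarrow> ('f, 'r, 'u) algebra set" where
  "Alg \<Omega> = {A. is_algebra \<Omega> A \<and> small TYPE('u) (carrier A)}"

definition hom ::
  "('f, 'r) signature \<Rightarrow> ('f, 'r, 'a) algebra \<Rightarrow> ('f, 'r, 'b) algebra \<Rightarrow> ('a \<Rightarrow> 'b) set" where
  "hom \<Omega> A B =
     {h \<in> carrier A \<rightarrow>\<^sub>E carrier B.
        \<forall>f\<in>ops \<Omega>. \<forall>x\<in>arity \<Omega> f \<rightarrow>\<^sub>E carrier A.
          h (oper A f x) = oper B f (\<lambda>r\<in>arity \<Omega> f. h (x r))}"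

definition iso ::
  "('f, 'r) signature \<Rightarrow> ('f, 'r, 'a) algebra \<Rightarrow> ('f, 'r, 'b) algebra \<Rightarrow> ('a \<Rightarrow> 'b) set" where
  "iso \<Omega> A B = {h \<in> hom \<Omega> A B. bij_betw h (carrier A) (carrier B)}"

definition isomorphic ::
  "('f, 'r) signature \<Rightarrow> ('f, 'r, 'a) algebra \<Rightarrow> ('f, 'r, 'b) algebra \<Rightarrow> bool" where
  "isomorphic \<Omega> A B \<longleftrightarrow> iso \<Omega> A B \<noteq> {}"

definition subalgebra ::
  "('f, 'r) signature \<Rightarrow> ('f, 'r, 'a) algebra \<Rightarrow> ('f, 'r, 'a) algebra \<Rightarrow> bool" where
  "subalgebra \<Omega> B A \<longleftrightarrow>
     is_algebra \<Omega> B \<and> carrier B \<subseteq> carrier A \<and>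
     (\<forall>f\<in>ops \<Omega>. \<forall>x\<in>arity \<Omega> f \<rightarrow>\<^sub>E carrier B. oper B f x = oper A f x)"

definition product_algebra ::
  "('f, 'r) signature \<Rightarrow> 'i set \<Rightarrow> ('i \<Rightarrow> ('f, 'r, 'a) algebra) \<Rightarrow> ('f, 'r, 'i \<Rightarrow> 'a) algebra" where
  "product_algebra \<Omega> I B =
     \<lparr>carrier = (\<Pi>\<^sub>E i\<in>I. carrier (B i)),
      oper = (\<lambda>f\<in>ops \<Omega>. \<lambda>x\<in>arity \<Omega> f \<rightarrow>\<^sub>E (\<Pi>\<^sub>E i\<in>I. carrier (B i)).
                \<lambda>i\<in>I. oper (B i) f (\<lambda>r\<in>arity \<Omega> f. x r i))\<rparr>"

text \<open>Meaningful when \<open>\<theta>\<close> is a congruence; the operations are computed on representatives.\<close>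

definition quotient_algebra ::
  "('f, 'r) signature \<Rightarrow> ('f, 'r, 'a) algebra \<Rightarrow> 'a rel \<Rightarrow> ('f, 'r, 'a set) algebra" where
  "quotient_algebra \<Omega> A \<theta> =
     \<lparr>carrier = carrier A // \<theta>,
      oper = (\<lambda>f\<in>ops \<Omega>. \<lambda>x\<in>arity \<Omega> f \<rightarrow>\<^sub>E (carrier A // \<theta>).
                \<theta> `` {oper A f (\<lambda>r\<in>arity \<Omega> f. SOME a. a \<in> x r)})\<rparr>"

definition S_closure ::
  "('f, 'r) signature \<Rightarrow> ('f, 'r, 'u) algebra set \<Rightarrow> ('f, 'r, 'u) algebra set" where
  "S_closure \<Omega> X = {A \<in> Alg \<Omega>. \<exists>B\<in>X. \<exists>C. subalgebra \<Omega> C B \<and> isomorphic \<Omega> A C}"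

definition P_closure ::
  "('f, 'r) signature \<Rightarrow> ('f, 'r, 'u) algebra set \<Rightarrow> ('f, 'r, 'u) algebra set" where
  "P_closure \<Omega> X =
     {A \<in> Alg \<Omega>. \<exists>(I :: 'u set) B. small TYPE('u) I \<and> (\<forall>i\<in>I. B i \<in> X) \<and>
        isomorphic \<Omega> A (product_algebra \<Omega> I B)}"

definition prevariety :: "('f, 'r) signature \<Rightarrow> ('f, 'r, 'u) algebra set \<Rightarrow> bool" where
  "prevariety \<Omega> P \<longleftrightarrow> P \<subseteq> Alg \<Omega> \<and> S_closure \<Omega> P \<subseteq> P \<and> P_closure \<Omega> P \<subseteq> P"

definition prevariety_generated ::
  "('f, 'r) signature \<Rightarrow> ('f, 'r, 'u) algebra set \<Rightarrow> ('f, 'r, 'u) algebra set" where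
  "prevariety_generated \<Omega> X = S_closure \<Omega> (P_closure \<Omega> X)"

definition residually_small :: "('f, 'r) signature \<Rightarrow> ('f, 'r, 'u) algebra set \<Rightarrow> bool" where
  "residually_small \<Omega> P \<longleftrightarrow>
     (\<exists>X \<subseteq> Alg \<Omega>. small TYPE('u) X \<and> P = prevariety_generated \<Omega> X)"

text \<open>An ultrafilter on a set \<open>I\<close> is an ultrafilter \<open>U\<close> with \<open>U \<le> principal I\<close>.\<close>

definition ultrafilter :: "'i filter \<Rightarrow> bool" where
  "ultrafilter U \<longleftrightarrow>
     U \<noteq> bot \<and> (\<forall>Q. eventually Q U \<or> eventually (\<lambda>i. \<not> Q i) U)"

definition ultraproduct ::
  "('f, 'r) signature \<Rightarrow> 'i set \<Rightarrow> ('i \<Rightarrow> ('f, 'r, 'a) algebra) \<Rightarrow> 'i filter \<Rightarrow>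
     ('f, 'r, ('i \<Rightarrow> 'a) set) algebra" where
  "ultraproduct \<Omega> I B U =
     quotient_algebra \<Omega> (product_algebra \<Omega> I B)
       {(x, y). x \<in> carrier (product_algebra \<Omega> I B) \<and> y \<in> carrier (product_algebra \<Omega> I B) \<and>
          eventually (\<lambda>i. x i = y i) U}"

text \<open>
  If some factor is empty, \<open>ultraproduct\<close> is empty, even when almost all factors are nonempty. This
  does not affect closure under ultraproducts of a prevariety: an empty algebra is a subalgebra of
  any other, and the index set may be cut down to the nonempty factors when these are almost all.
\<close>

definition quasivariety :: "('f, 'r) signature \<Rightarrow> ('f, 'r, 'u) algebra set \<Rightarrow> bool" where
  "quasivariety \<Omega> P \<longleftrightarrow>
     prevariety \<Omega> P \<and> finitary \<Omega> \<and>
     (\<forall>(I :: 'u set) B U. \<forall>A\<in>Alg \<Omega>.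
        small TYPE('u) I \<and> (\<forall>i\<in>I. B i \<in> P) \<and> ultrafilter U \<and> U \<le> principal I \<and>
        isomorphic \<Omega> A (ultraproduct \<Omega> I B U) \<longrightarrow> A \<in> P)"

definition subdirect_product ::
  "('f, 'r) signature \<Rightarrow> ('f, 'r, 'i \<Rightarrow> 'a) algebra \<Rightarrow> 'i set \<Rightarrow> ('i \<Rightarrow> ('f, 'r, 'a) algebra) \<Rightarrow> bool"
where
  "subdirect_product \<Omega> C I B \<longleftrightarrow>
     subalgebra \<Omega> C (product_algebra \<Omega> I B) \<and>
     (\<forall>i\<in>I. (\<lambda>x. x i) ` carrier C = carrier (B i))"

definition subdirectly_irreducible ::
  "('f, 'r) signature \<Rightarrow> ('f, 'r, 'u) algebra set \<Rightarrow> ('f, 'r, 'u) algebra \<Rightarrow> bool" where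
  "subdirectly_irreducible \<Omega> P A \<longleftrightarrow>
     A \<in> P \<and>
     (\<forall>(I :: 'u set) B C.
        small TYPE('u) I \<and> (\<forall>i\<in>I. B i \<in> P) \<and> subdirect_product \<Omega> C I B \<and> isomorphic \<Omega> A C \<longrightarrow>
        (\<exists>i\<in>I. (\<lambda>x\<in>carrier C. x i) \<in> iso \<Omega> C (B i)))"

definition is_coproduct ::
  "('f, 'r) signature \<Rightarrow> ('f, 'r, 'u) algebra set \<Rightarrow> ('f, 'r, 'u) algebra set \<Rightarrow>
     ('f, 'r, 'u) algebra \<Rightarrow> (('f, 'r, 'u) algebra \<Rightarrow> 'u \<Rightarrow> 'u) \<Rightarrow> bool" where
  "is_coproduct \<Omega> P X C q \<longleftrightarrow>
     C \<in> P \<and> (\<forall>A\<in>X. q A \<in> hom \<Omega> A C) \<and>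
     (\<forall>D\<in>P. \<forall>g. (\<forall>A\<in>X. g A \<in> hom \<Omega> A D) \<longrightarrow>
        (\<exists>!h. h \<in> hom \<Omega> C D \<and> (\<forall>A\<in>X. compose (carrier A) h (q A) = g A)))"

definition compatible ::
  "('f, 'r) signature \<Rightarrow> ('f, 'r, 'u) algebra set \<Rightarrow> ('f, 'r, 'u) algebra set \<Rightarrow> bool" where
  "compatible \<Omega> P X \<longleftrightarrow>
     X \<subseteq> P \<and> small TYPE('u) X \<and>
     (\<exists>C q. is_coproduct \<Omega> P X C q \<and> (\<forall>A\<in>X. inj_on (q A) (carrier A)))"

definition generated_by_at_most ::
  "('f, 'r) signature \<Rightarrow> 'k rel \<Rightarrow> ('f, 'r, 'u) algebra set \<Rightarrow> bool" where
  "generated_by_at_most \<Omega> \<kappa> P \<longleftrightarrow>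
     (\<exists>X \<subseteq> Alg \<Omega>. small TYPE('u) X \<and> |X| \<le>o \<kappa> \<and> P = prevariety_generated \<Omega> X)"

definition irreducibles_covered ::
  "('f, 'r) signature \<Rightarrow> 'k rel \<Rightarrow> ('f, 'r, 'u) algebra set \<Rightarrow> bool" where
  "irreducibles_covered \<Omega> \<kappa> P \<longleftrightarrow>
     (\<forall>X. small TYPE('u) X \<and> (\<forall>A\<in>X. subdirectly_irreducible \<Omega> P A) \<longrightarrow>
        (\<exists>Y :: 'k \<Rightarrow> ('f, 'r, 'u) algebra set.
           X = (\<Union>\<alpha>\<in>Field \<kappa>. Y \<alpha>) \<and> (\<forall>\<alpha>\<in>Field \<kappa>. compatible \<Omega> P (Y \<alpha>))))"

end

theory Submission
  imports Defs
begin

text \<open>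
  An algebra lies in the prevariety generated by \<open>X\<close> iff homomorphisms into members of \<open>X\<close>
  separate its points, and a subdirectly irreducible algebra with this property embeds in a single
  member of \<open>X\<close>. Hence, if \<open>\<kappa>\<close> algebras generate \<open>P\<close>, the subdirectly irreducibles can be sorted by
  a generator into which they embed, and those embedding in a common member of \<open>P\<close> embed in their
  coproduct. Conversely, in a quasivariety the kernels of homomorphisms to members of \<open>P\<close> are closed
  under unions of chains, by an ultraproduct argument, so a maximal kernel not identifying two given
  points exists and has a subdirectly irreducible image. The subdirectly irreducibles form a set up
  to isomorphism, and the coproducts of its \<open>\<kappa>\<close> compatible pieces generate \<open>P\<close>.
\<close>

section \<open>Small sets and ultrafilters\<close>

text \<open>Size is the recurring obstacle. \<open>P\<close> contains only algebras carried by small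
  subsets of \<open>'u\<close>, while products and ultraproducts live on function and set types, so
  each construction is shown to be small and then replaced by a copy over \<open>'u\<close>. Closure
  of the small sets under powers, sums and dependent products is what the universe contributes. The
  subdirectly irreducible algebras form a set up to isomorphism because each embeds in one member of
  a small generating set, hence has a copy carried by a subset of that member. Likewise a coproduct
  exists because, over a small generating set, the cocones to be considered form a set. Finite arity
  and ultraproducts enter through subdirect representation: in a general prevariety the union of a
  chain of kernels need not be a kernel of the same kind, Zorn's lemma has nothing to work on, and
  there may be too few subdirectly irreducible algebras for condition (2) to say much about
  \<open>P\<close>.\<close>

lemma small_subset: "small U T \<Longrightarrow> S \<subseteq> T \<Longrightarrow> small U S"
  unfolding small_def using card_of_mono1 ordLeq_ordLess_trans by blast

lemma small_image: "small U S \<Longrightarrow> small U (f ` S)"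
  unfolding small_def using card_of_image ordLeq_ordLess_trans by blast

lemma small_embedding:
  assumes "small (U :: 'u itself) S"
  obtains e :: "'x \<Rightarrow> 'u" where "inj_on e S"
proof -
  have "|S| \<le>o |UNIV :: 'u set|"
    using assms unfolding small_def by (rule ordLess_imp_ordLeq)
  then show ?thesis
    using that card_of_ordLeq[of S "UNIV :: 'u set"] by blast
qed

text \<open>The strong limit property of the universe speaks of subsets of \<open>'u\<close>, so
  \<open>S\<close> is moved into \<open>'u\<close> along an injection \<open>e\<close>, and each
  subset of \<open>S\<close> is recovered as the preimage of its image.\<close>

lemma small_Pow:
  assumes U: "universe (U :: 'u itself)" and S: "small U S"
  shows "small U (Pow S)"
proof -
  obtain e :: "_ \<Rightarrow> 'u" where e: "inj_on e S"
    using S by (rule small_embedding)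
  have "small U (Pow (e ` S))"
    using U small_image[OF S, of e] unfolding universe_def small_def by blast
  then have "small U ((\<lambda>T. {x \<in> S. e x \<in> T}) ` Pow (e ` S))"
    by (rule small_image)
  moreover have "Pow S \<subseteq> (\<lambda>T. {x \<in> S. e x \<in> T}) ` Pow (e ` S)"
  proof
    fix T assume "T \<in> Pow S"
    then have T: "T \<subseteq> S"
      by simp
    have "T = {x \<in> S. e x \<in> e ` T}" "e ` T \<in> Pow (e ` S)"
      using T inj_on_image_mem_iff[OF e _ T] by blast+
    then show "T \<in> (\<lambda>T. {x \<in> S. e x \<in> T}) ` Pow (e ` S)"
      by (rule image_eqI)
  qed
  ultimately show ?thesis
    by (rule small_subset)
qed

text \<open>Regularity of the cardinal of \<open>'u\<close>, in its form as stability: a sum of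
  fewer than that many sets, each of smaller size, stays smaller.\<close>

lemma small_Sigma:
  assumes U: "universe (U :: 'u itself)" and S: "small U S" and T: "\<And>s. s \<in> S \<Longrightarrow> small U (T s)"
  shows "small U (Sigma S T)"
proof -
  have "stable |UNIV :: 'u set|"
    using U unfolding universe_def
    by (intro regularCard_stable) (auto simp: card_of_card_order_on Field_card_of)
  then show ?thesis
    using S T unfolding small_def by (rule stable_elim)
qed

lemma small_UN:
  assumes "universe (U :: 'u itself)" and "small U S" and "\<And>s. s \<in> S \<Longrightarrow> small U (T s)"
  shows "small U (\<Union>s\<in>S. T s)"
proof -
  have *: "(\<Union>s\<in>S. T s) = snd ` Sigma S T"
    by force
  show ?thesis
    unfolding * by (rule small_image, rule small_Sigma[OF assms])
qed

text \<open>A function on \<open>S\<close> is coded by its graph, a subset of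
  \<open>Sigma S T\<close>, which \<open>F\<close> decodes; regularity and the strong limit property
  together thus bound function spaces.\<close>

lemma small_PiE:
  fixes S :: "'a set" and T :: "'a \<Rightarrow> 'b set"
  assumes U: "universe (U :: 'u itself)" and S: "small U S" and T: "\<And>s. s \<in> S \<Longrightarrow> small U (T s)"
  shows "small U (PiE S T)"
proof -
  define F where "F = (\<lambda>G :: ('a \<times> 'b) set. \<lambda>s\<in>S. THE y. (s, y) \<in> G)"
  have "small U (F ` Pow (Sigma S T))"
    by (intro small_image small_Pow small_Sigma U S T)
  moreover have "PiE S T \<subseteq> F ` Pow (Sigma S T)"
  proof
    fix f assume f: "f \<in> PiE S T"
    have "F ((\<lambda>s. (s, f s)) ` S) = f"
    proof
      fix s
      show "F ((\<lambda>s. (s, f s)) ` S) s = f s"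
      proof (cases "s \<in> S")
        case True
        then have "(THE y. (s, y) \<in> (\<lambda>s. (s, f s)) ` S) = f s"
          by (intro the_equality) auto
        with True show ?thesis
          unfolding F_def by simp
      next
        case False
        then show ?thesis
          using PiE_arb[OF f] unfolding F_def by simp
      qed
    qed
    moreover have "(\<lambda>s. (s, f s)) ` S \<in> Pow (Sigma S T)"
      using f by auto
    ultimately show "f \<in> F ` Pow (Sigma S T)"
      by (metis image_eqI)
  qed
  ultimately show ?thesis
    by (rule small_subset)
qed

text \<open>Zorn's lemma for the proper filters below \<open>F\<close>, with the order reversed
  because finer filters are smaller. A minimal proper filter decides every \<open>Q\<close>: either
  \<open>Q\<close> is inconsistent with it, or adjoining \<open>Q\<close> changes nothing.\<close>

lemma ultrafilter_below:
  assumes "F \<noteq> bot"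
  obtains U where "ultrafilter U" "U \<le> F"
proof -
  define A where "A = {G. G \<noteq> bot \<and> G \<le> F}"
  have "\<exists>M\<in>A. \<forall>G\<in>A. G \<le> M \<longrightarrow> G = M"
  proof (rule predicate_Zorn)
    show "partial_order_on A (relation_of (\<lambda>G H. H \<le> G) A)"
      by (rule partial_order_on_relation_ofI) auto
  next
    fix C assume C: "C \<in> Chains (relation_of (\<lambda>G H. H \<le> G) A)"
    show "\<exists>u\<in>A. \<forall>a\<in>C. u \<le> a"
    proof (cases "C = {}")
      case True
      then show ?thesis
        using assms unfolding A_def by auto
    next
      case False
      have sub: "G \<noteq> bot" "G \<le> F" if "G \<in> C" for G
        using C that unfolding Chains_def relation_of_def A_def by blast+
      have lin: "G \<le> H \<or> H \<le> G" if "G \<in> C" "H \<in> C" for G H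
        using C that unfolding Chains_def relation_of_def by blast
      \<comment> \<open>A chain is directed, so what holds eventually for its infimum already holds
        eventually for a single member; hence the infimum can be improper only if a member
        is.\<close>
      have ev: "eventually Q (Inf C) \<longleftrightarrow> (\<exists>G\<in>C. eventually Q G)" for Q
        using False
      proof (rule eventually_Inf_base)
        show "\<exists>x\<in>C. x \<le> inf G H" if "G \<in> C" "H \<in> C" for G H
          using lin[OF that] that by auto
      qed
      have "Inf C \<noteq> bot"
        using sub(1) unfolding trivial_limit_def ev by blast
      moreover have "Inf C \<le> F"
        using False sub(2) by (meson Inf_lower2 ex_in_conv)
      ultimately show ?thesis
        unfolding A_def by (auto intro: Inf_lower)
    qed
  qed
  then obtain M where M: "M \<noteq> bot" "M \<le> F" and max: "\<And>G. G \<noteq> bot \<Longrightarrow> G \<le> M \<Longrightarrow> G = M"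
    unfolding A_def by (auto dest: order_trans)
  have "eventually Q M \<or> eventually (\<lambda>i. \<not> Q i) M" for Q
  proof (cases "inf M (principal {i. Q i}) = bot")
    case True
    then have "eventually (\<lambda>i. \<not> Q i) M"
      unfolding trivial_limit_def eventually_inf_principal by simp
    then show ?thesis ..
  next
    case False
    then have "inf M (principal {i. Q i}) = M"
      by (intro max) auto
    moreover have "eventually Q (inf M (principal {i. Q i}))"
      unfolding eventually_inf_principal by simp
    ultimately show ?thesis
      by simp
  qed
  with M that show ?thesis
    unfolding ultrafilter_def by blast
qed

section \<open>Homomorphisms, images and products\<close>

text \<open>The restrictions supply the extensionality that \<open>is_algebra\<close> demands, so
  \<open>F\<close> need only behave on arguments from \<open>S\<close>. Products, ultraproducts,
  images and generated subalgebras are all instances and share one proof obligation, closure of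
  \<open>S\<close>.\<close>

abbreviation mk_algebra ::
  "('f, 'r) signature \<Rightarrow> 'a set \<Rightarrow> ('f \<Rightarrow> ('r \<Rightarrow> 'a) \<Rightarrow> 'a) \<Rightarrow> ('f, 'r, 'a) algebra" where
  "mk_algebra \<Omega> S F \<equiv>
     \<lparr>carrier = S, oper = (\<lambda>f\<in>ops \<Omega>. \<lambda>x\<in>arity \<Omega> f \<rightarrow>\<^sub>E S. F f x)\<rparr>"

lemma restrict_eq_PiE:
  assumes "x \<in> PiE R S" and "\<And>r. r \<in> R \<Longrightarrow> F r = x r"
  shows "restrict F R = x"
  using restrict_ext[of R F x] PiE_restrict[OF assms(1)] assms(2) by simp

lemma is_algebra_mk:
  "(\<And>f x. f \<in> ops \<Omega> \<Longrightarrow> x \<in> arity \<Omega> f \<rightarrow>\<^sub>E S \<Longrightarrow> F f x \<in> S) \<Longrightarrow> is_algebra \<Omega> (mk_algebra \<Omega> S F)"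
  unfolding is_algebra_def by simp

lemma oper_closed:
  assumes A: "is_algebra \<Omega> A" and f: "f \<in> ops \<Omega>" and x: "x \<in> arity \<Omega> f \<rightarrow>\<^sub>E carrier A"
  shows "oper A f x \<in> carrier A"
  using PiE_mem[OF PiE_mem[OF A[unfolded is_algebra_def] f] x] .

lemma Alg_is_algebra: "A \<in> Alg \<Omega> \<Longrightarrow> is_algebra \<Omega> A"
  unfolding Alg_def by blast

lemma hom_mem: "h \<in> hom \<Omega> A B \<Longrightarrow> a \<in> carrier A \<Longrightarrow> h a \<in> carrier B"
  unfolding hom_def by auto

lemma hom_oper:
  "h \<in> hom \<Omega> A B \<Longrightarrow> f \<in> ops \<Omega> \<Longrightarrow> x \<in> arity \<Omega> f \<rightarrow>\<^sub>E carrier A \<Longrightarrow>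
   h (oper A f x) = oper B f (\<lambda>r\<in>arity \<Omega> f. h (x r))"
  unfolding hom_def by blast

lemma hom_args:
  assumes "h \<in> hom \<Omega> A B" and "x \<in> R \<rightarrow>\<^sub>E carrier A"
  shows "(\<lambda>r\<in>R. h (x r)) \<in> R \<rightarrow>\<^sub>E carrier B"
  using hom_mem[OF assms(1) PiE_mem[OF assms(2)]] by simp

lemma restrict_homI:
  assumes "is_algebra \<Omega> A"
    and "\<And>a. a \<in> carrier A \<Longrightarrow> h a \<in> carrier B"
    and "\<And>f x. f \<in> ops \<Omega> \<Longrightarrow> x \<in> arity \<Omega> f \<rightarrow>\<^sub>E carrier A \<Longrightarrow>
           h (oper A f x) = oper B f (\<lambda>r\<in>arity \<Omega> f. h (x r))"
  shows "restrict h (carrier A) \<in> hom \<Omega> A B"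
proof -
  have "(\<lambda>r\<in>arity \<Omega> f. restrict h (carrier A) (x r)) = (\<lambda>r\<in>arity \<Omega> f. h (x r))"
    if "x \<in> arity \<Omega> f \<rightarrow>\<^sub>E carrier A" for f x
    using PiE_mem[OF that] by (intro restrict_ext) simp
  then show ?thesis
    using assms(2,3) oper_closed[OF assms(1)] unfolding hom_def by simp
qed

lemma hom_ext:
  "h \<in> hom \<Omega> A B \<Longrightarrow> k \<in> hom \<Omega> A B' \<Longrightarrow> (\<And>a. a \<in> carrier A \<Longrightarrow> h a = k a) \<Longrightarrow> h = k"
  by (rule extensionalityI[of h "carrier A" k]) (auto simp: hom_def PiE_def)

lemma hom_id: "is_algebra \<Omega> A \<Longrightarrow> (\<lambda>a\<in>carrier A. a) \<in> hom \<Omega> A A"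
proof (rule restrict_homI)
  fix f x assume "x \<in> arity \<Omega> f \<rightarrow>\<^sub>E carrier A"
  then have "(\<lambda>r\<in>arity \<Omega> f. x r) = x"
    by (rule restrict_eq_PiE) simp
  then show "oper A f x = oper A f (\<lambda>r\<in>arity \<Omega> f. x r)"
    by simp
qed auto

lemma hom_compose:
  assumes A: "is_algebra \<Omega> A" and h: "h \<in> hom \<Omega> A B" and k: "k \<in> hom \<Omega> B C"
  shows "compose (carrier A) k h \<in> hom \<Omega> A C"
  unfolding compose_def
proof (rule restrict_homI[OF A])
  show "k (h a) \<in> carrier C" if "a \<in> carrier A" for a
    using that by (intro hom_mem[OF k] hom_mem[OF h])
  fix f x assume fx: "f \<in> ops \<Omega>" "x \<in> arity \<Omega> f \<rightarrow>\<^sub>E carrier A"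
  show "k (h (oper A f x)) = oper C f (\<lambda>r\<in>arity \<Omega> f. k (h (x r)))"
    unfolding hom_oper[OF h fx] hom_oper[OF k fx(1) hom_args[OF h fx(2)]]
    by (intro arg_cong[where f = "oper C f"] restrict_ext) simp
qed

lemma inj_on_hom_compose:
  assumes h: "h \<in> hom \<Omega> A B" "inj_on h (carrier A)" and k: "inj_on k (carrier B)"
  shows "inj_on (compose (carrier A) k h) (carrier A)"
proof (rule inj_onI)
  fix a b assume ab: "a \<in> carrier A" "b \<in> carrier A"
    and "compose (carrier A) k h a = compose (carrier A) k h b"
  then have "k (h a) = k (h b)"
    by (simp add: compose_eq)
  then show "a = b"
    using inj_onD[OF k] inj_onD[OF h(2)] hom_mem[OF h(1)] ab by blast
qed

lemma iso_hom: "h \<in> iso \<Omega> A B \<Longrightarrow> h \<in> hom \<Omega> A B"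
  and iso_inj: "h \<in> iso \<Omega> A B \<Longrightarrow> inj_on h (carrier A)"
  and iso_image: "h \<in> iso \<Omega> A B \<Longrightarrow> h ` carrier A = carrier B"
  unfolding iso_def bij_betw_def by auto

lemma isoI: "h \<in> hom \<Omega> A B \<Longrightarrow> inj_on h (carrier A) \<Longrightarrow> h ` carrier A = carrier B \<Longrightarrow> h \<in> iso \<Omega> A B"
  unfolding iso_def bij_betw_def by auto

lemma iso_sym:
  assumes A: "is_algebra \<Omega> A" and B: "is_algebra \<Omega> B" and h: "h \<in> iso \<Omega> A B"
  shows "restrict (inv_into (carrier A) h) (carrier B) \<in> iso \<Omega> B A"
proof (rule isoI)
  let ?k = "inv_into (carrier A) h"
  note bij = iso_inj[OF h] iso_image[OF h]
  have k: "?k b \<in> carrier A" "h (?k b) = b" if "b \<in> carrier B" for b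
    using that unfolding bij(2)[symmetric] by (rule inv_into_into, rule f_inv_into_f)
  show "restrict ?k (carrier B) \<in> hom \<Omega> B A"
  proof (rule restrict_homI[OF B k(1)])
    fix f x assume f: "f \<in> ops \<Omega>" and x: "x \<in> arity \<Omega> f \<rightarrow>\<^sub>E carrier B"
    let ?y = "\<lambda>r\<in>arity \<Omega> f. ?k (x r)"
    have y: "?y \<in> arity \<Omega> f \<rightarrow>\<^sub>E carrier A"
      using k(1)[OF PiE_mem[OF x]] by simp
    have "(\<lambda>r\<in>arity \<Omega> f. h (?y r)) = x"
      using k(2)[OF PiE_mem[OF x]] by (intro restrict_eq_PiE[OF x]) simp
    then have "h (oper A f ?y) = oper B f x"
      using hom_oper[OF iso_hom[OF h] f y] by simp
    then show "?k (oper B f x) = oper A f ?y"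
      using inv_into_f_f[OF bij(1) oper_closed[OF A f y]] by simp
  qed
  show "inj_on (restrict ?k (carrier B)) (carrier B)"
    by (rule inj_on_inverseI[of _ h]) (simp add: k(2))
  show "restrict ?k (carrier B) ` carrier B = carrier A"
    using inv_into_image_cancel[OF bij(1) subset_refl] unfolding bij(2) image_restrict_eq .
qed

lemma iso_compose:
  assumes A: "is_algebra \<Omega> A" and h: "h \<in> iso \<Omega> A B" and k: "k \<in> iso \<Omega> B C"
  shows "compose (carrier A) k h \<in> iso \<Omega> A C"
  using hom_compose[OF A iso_hom[OF h] iso_hom[OF k]] h k
  unfolding iso_def by (auto intro: bij_betw_compose)

section \<open>Subalgebras and images of homomorphisms\<close>

lemma subalgebra_oper:
  "subalgebra \<Omega> C B \<Longrightarrow> f \<in> ops \<Omega> \<Longrightarrow> x \<in> arity \<Omega> f \<rightarrow>\<^sub>E carrier C \<Longrightarrow> oper C f x = oper B f x"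
  unfolding subalgebra_def by blast

lemma subalgebra_carrier: "subalgebra \<Omega> C B \<Longrightarrow> carrier C \<subseteq> carrier B"
  unfolding subalgebra_def by blast

lemma subalgebra_is_algebra: "subalgebra \<Omega> C B \<Longrightarrow> is_algebra \<Omega> C"
  unfolding subalgebra_def by blast

lemma hom_subalgebra_iff:
  assumes "subalgebra \<Omega> C B"
  shows "h \<in> hom \<Omega> A C \<longleftrightarrow> h \<in> hom \<Omega> A B \<and> h ` carrier A \<subseteq> carrier C"
proof -
  have "oper C f (\<lambda>r\<in>arity \<Omega> f. h (x r)) = oper B f (\<lambda>r\<in>arity \<Omega> f. h (x r))"
    if h: "\<forall>a\<in>carrier A. h a \<in> carrier C" and f: "f \<in> ops \<Omega>"
      and x: "x \<in> arity \<Omega> f \<rightarrow>\<^sub>E carrier A" for f x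
    using h PiE_mem[OF x] by (intro subalgebra_oper[OF assms f]) simp
  moreover have "h \<in> carrier A \<rightarrow>\<^sub>E carrier C \<longleftrightarrow>
      h \<in> carrier A \<rightarrow>\<^sub>E carrier B \<and> (\<forall>a\<in>carrier A. h a \<in> carrier C)"
    using subalgebra_carrier[OF assms] unfolding PiE_iff by blast
  ultimately show ?thesis
    unfolding hom_def image_subset_iff by auto
qed

lemma subalgebra_mk:
  "S \<subseteq> carrier B \<Longrightarrow> (\<And>f x. f \<in> ops \<Omega> \<Longrightarrow> x \<in> arity \<Omega> f \<rightarrow>\<^sub>E S \<Longrightarrow> oper B f x \<in> S) \<Longrightarrow>
   subalgebra \<Omega> (mk_algebra \<Omega> S (oper B)) B"
  unfolding subalgebra_def using is_algebra_mk[of \<Omega> S "oper B"] by auto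

abbreviation image_algebra ::
  "('f, 'r) signature \<Rightarrow> ('a \<Rightarrow> 'b) \<Rightarrow> ('f, 'r, 'a) algebra \<Rightarrow> ('f, 'r, 'b) algebra \<Rightarrow> ('f, 'r, 'b) algebra"
where
  "image_algebra \<Omega> h A B \<equiv> mk_algebra \<Omega> (h ` carrier A) (oper B)"

lemma image_subalgebra:
  assumes A: "is_algebra \<Omega> A" and h: "h \<in> hom \<Omega> A B"
  shows "subalgebra \<Omega> (image_algebra \<Omega> h A B) B"
proof (rule subalgebra_mk)
  show "h ` carrier A \<subseteq> carrier B"
    using hom_mem[OF h] by blast
  fix f x assume f: "f \<in> ops \<Omega>" and x: "x \<in> arity \<Omega> f \<rightarrow>\<^sub>E h ` carrier A"
  \<comment> \<open>Preimages of all arguments, possibly infinitely many, are chosen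
    simultaneously.\<close>
  define y where "y = (\<lambda>r\<in>arity \<Omega> f. inv_into (carrier A) h (x r))"
  have y: "y \<in> arity \<Omega> f \<rightarrow>\<^sub>E carrier A"
    using inv_into_into[OF PiE_mem[OF x]] unfolding y_def by simp
  have "(\<lambda>r\<in>arity \<Omega> f. h (y r)) = x"
    using f_inv_into_f[OF PiE_mem[OF x]] unfolding y_def by (intro restrict_eq_PiE[OF x]) simp
  then have "oper B f x = h (oper A f y)"
    using hom_oper[OF h f y] by simp
  then show "oper B f x \<in> h ` carrier A"
    using oper_closed[OF A f y] by blast
qed

lemma hom_image:
  "is_algebra \<Omega> A \<Longrightarrow> h \<in> hom \<Omega> A B \<Longrightarrow> h \<in> hom \<Omega> A (image_algebra \<Omega> h A B)"
  by (rule hom_subalgebra_iff[OF image_subalgebra, THEN iffD2]) auto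

lemma iso_image_algebra:
  "is_algebra \<Omega> A \<Longrightarrow> h \<in> hom \<Omega> A B \<Longrightarrow> inj_on h (carrier A) \<Longrightarrow> h \<in> iso \<Omega> A (image_algebra \<Omega> h A B)"
  by (intro isoI hom_image) auto

section \<open>Direct products, and copies of small algebras over the universe\<close>

lemma product_mk:
  "product_algebra \<Omega> I B =
     mk_algebra \<Omega> (\<Pi>\<^sub>E i\<in>I. carrier (B i)) (\<lambda>f x. \<lambda>i\<in>I. oper (B i) f (\<lambda>r\<in>arity \<Omega> f. x r i))"
  unfolding product_algebra_def ..

lemma product_carrier: "carrier (product_algebra \<Omega> I B) = (\<Pi>\<^sub>E i\<in>I. carrier (B i))"
  unfolding product_algebra_def by simp

lemma product_is_algebra:
  assumes "\<And>i. i \<in> I \<Longrightarrow> is_algebra \<Omega> (B i)"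
  shows "is_algebra \<Omega> (product_algebra \<Omega> I B)"
  unfolding product_mk
proof (rule is_algebra_mk)
  fix f x assume "f \<in> ops \<Omega>" and x: "x \<in> arity \<Omega> f \<rightarrow>\<^sub>E (\<Pi>\<^sub>E i\<in>I. carrier (B i))"
  moreover have "(\<lambda>r\<in>arity \<Omega> f. x r i) \<in> arity \<Omega> f \<rightarrow>\<^sub>E carrier (B i)" if "i \<in> I" for i
    using x that by (auto simp: PiE_iff)
  ultimately show "(\<lambda>i\<in>I. oper (B i) f (\<lambda>r\<in>arity \<Omega> f. x r i)) \<in> (\<Pi>\<^sub>E i\<in>I. carrier (B i))"
    using assms oper_closed by fastforce
qed

lemma hom_projection:
  assumes B: "\<And>i. i \<in> I \<Longrightarrow> is_algebra \<Omega> (B i)" and i: "i \<in> I"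
  shows "(\<lambda>x\<in>carrier (product_algebra \<Omega> I B). x i) \<in> hom \<Omega> (product_algebra \<Omega> I B) (B i)"
  using i by (intro restrict_homI product_is_algebra B) (auto simp: product_algebra_def)

lemma hom_tuple:
  assumes A: "is_algebra \<Omega> A" and h: "\<And>i. i \<in> I \<Longrightarrow> h i \<in> hom \<Omega> A (B i)"
  shows "(\<lambda>a\<in>carrier A. \<lambda>i\<in>I. h i a) \<in> hom \<Omega> A (product_algebra \<Omega> I B)"
proof (rule restrict_homI[OF A])
  show "(\<lambda>i\<in>I. h i a) \<in> carrier (product_algebra \<Omega> I B)" if "a \<in> carrier A" for a
    using hom_mem[OF h that] by (simp add: product_carrier)
  fix f x assume f: "f \<in> ops \<Omega>" and x: "x \<in> arity \<Omega> f \<rightarrow>\<^sub>E carrier A"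
  have "(\<lambda>r\<in>arity \<Omega> f. \<lambda>i\<in>I. h i (x r)) \<in> arity \<Omega> f \<rightarrow>\<^sub>E (\<Pi>\<^sub>E i\<in>I. carrier (B i))"
    using x hom_mem[OF h] by (fastforce simp: PiE_iff)
  then show "(\<lambda>i\<in>I. h i (oper A f x)) =
      oper (product_algebra \<Omega> I B) f (\<lambda>r\<in>arity \<Omega> f. \<lambda>i\<in>I. h i (x r))"
    using f by (auto simp: product_algebra_def hom_oper[OF h f x] cong: restrict_cong intro!: restrict_ext)
qed

lemma product_small:
  assumes "universe (U :: 'u itself)" and "small U I" and "\<And>i. i \<in> I \<Longrightarrow> small U (carrier (B i))"
  shows "small U (carrier (product_algebra \<Omega> I B))"
  unfolding product_carrier using assms by (rule small_PiE)

text \<open>Membership in \<open>P\<close> makes sense only for algebras over \<open>'u\<close>,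
  whereas products and ultraproducts have other carrier types. A small carrier injects into
  \<open>'u\<close>, and the operations are carried along that injection.\<close>

lemma transport:
  assumes A: "is_algebra \<Omega> A" and sm: "small TYPE('u) (carrier A)"
  obtains A' :: "('f, 'r, 'u) algebra" and h where "A' \<in> Alg \<Omega>" "h \<in> iso \<Omega> A A'"
proof -
  obtain e :: "_ \<Rightarrow> 'u" where e: "inj_on e (carrier A)"
    using sm by (rule small_embedding)
  let ?k = "inv_into (carrier A) e"
  let ?A = "mk_algebra \<Omega> (e ` carrier A) (\<lambda>f x. e (oper A f (\<lambda>r\<in>arity \<Omega> f. ?k (x r))))"
  have k: "(\<lambda>r\<in>R. ?k (x r)) \<in> R \<rightarrow>\<^sub>E carrier A" if "x \<in> R \<rightarrow>\<^sub>E e ` carrier A" for x and R :: "'r set"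
    using inv_into_into[OF PiE_mem[OF that]] by simp
  have "is_algebra \<Omega> ?A"
    by (rule is_algebra_mk) (intro imageI oper_closed[OF A] k)
  then have "?A \<in> Alg \<Omega>"
    unfolding Alg_def using small_image[OF sm] by simp
  moreover have "restrict e (carrier A) \<in> iso \<Omega> A ?A"
  proof (intro isoI restrict_homI A)
    fix f x assume f: "f \<in> ops \<Omega>" and x: "x \<in> arity \<Omega> f \<rightarrow>\<^sub>E carrier A"
    have "(\<lambda>r\<in>arity \<Omega> f. e (x r)) \<in> arity \<Omega> f \<rightarrow>\<^sub>E e ` carrier A"
      using PiE_mem[OF x] by simp
    moreover have "(\<lambda>r\<in>arity \<Omega> f. ?k ((\<lambda>r\<in>arity \<Omega> f. e (x r)) r)) = x"
      using inv_into_f_f[OF e PiE_mem[OF x]] by (intro restrict_eq_PiE[OF x]) simp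
    ultimately show "e (oper A f x) = oper ?A f (\<lambda>r\<in>arity \<Omega> f. e (x r))"
      using f by simp
  qed (use e in \<open>auto simp: inj_on_def\<close>)
  ultimately show ?thesis
    by (rule that)
qed

section \<open>Prevarieties in terms of separating homomorphisms\<close>

text \<open>The two carrier types differ so that the criterion also applies to a product that has
  not yet been copied into \<open>'u\<close>.\<close>

definition separated ::
  "('f, 'r) signature \<Rightarrow> ('f, 'r, 'b) algebra set \<Rightarrow> ('f, 'r, 'a) algebra \<Rightarrow> bool" where
  "separated \<Omega> X A \<longleftrightarrow>
     (\<forall>a\<in>carrier A. \<forall>b\<in>carrier A. a \<noteq> b \<longrightarrow> (\<exists>B\<in>X. \<exists>h\<in>hom \<Omega> A B. h a \<noteq> h b))"

lemma separatedI:
  "(\<And>a b. a \<in> carrier A \<Longrightarrow> b \<in> carrier A \<Longrightarrow> a \<noteq> b \<Longrightarrow> \<exists>B\<in>X. \<exists>h\<in>hom \<Omega> A B. h a \<noteq> h b) \<Longrightarrow>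
   separated \<Omega> X A"
  unfolding separated_def by blast

lemma separatedE:
  assumes "separated \<Omega> X A" "a \<in> carrier A" "b \<in> carrier A" "a \<noteq> b"
  obtains B h where "B \<in> X" "h \<in> hom \<Omega> A B" "h a \<noteq> h b"
  using assms unfolding separated_def by blast

lemma separated_self: "is_algebra \<Omega> A \<Longrightarrow> A \<in> X \<Longrightarrow> separated \<Omega> X A"
  by (rule separatedI, rule bexI[of _ A], rule bexI[OF _ hom_id]) auto

text \<open>Separating homomorphisms are pulled back along \<open>k\<close>. This covers passage to
  subalgebras and to isomorphic copies alike.\<close>

lemma separated_hom:
  assumes A: "is_algebra \<Omega> A" and k: "k \<in> hom \<Omega> A C" "inj_on k (carrier A)" and C: "separated \<Omega> X C"
  shows "separated \<Omega> X A"
proof (rule separatedI)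
  fix a b assume ab: "a \<in> carrier A" "b \<in> carrier A" "a \<noteq> b"
  then have "k a \<noteq> k b"
    using k(2) by (auto simp: inj_on_def)
  then obtain B h where B: "B \<in> X" "h \<in> hom \<Omega> C B" "h (k a) \<noteq> h (k b)"
    using separatedE[OF C hom_mem[OF k(1) ab(1)] hom_mem[OF k(1) ab(2)]] by metis
  then have "compose (carrier A) h k a \<noteq> compose (carrier A) h k b"
    using ab by (simp add: compose_def)
  with B(1) hom_compose[OF A k(1) B(2)] show "\<exists>B\<in>X. \<exists>h\<in>hom \<Omega> A B. h a \<noteq> h b"
    by blast
qed

lemma separated_product:
  assumes B: "\<And>i. i \<in> I \<Longrightarrow> is_algebra \<Omega> (B i)" and X: "\<And>i. i \<in> I \<Longrightarrow> B i \<in> X"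
  shows "separated \<Omega> X (product_algebra \<Omega> I B)"
proof (rule separatedI)
  fix x y assume xy: "x \<in> carrier (product_algebra \<Omega> I B)" "y \<in> carrier (product_algebra \<Omega> I B)" "x \<noteq> y"
  then obtain i where i: "i \<in> I" "x i \<noteq> y i"
    unfolding product_carrier using PiE_ext by metis
  show "\<exists>D\<in>X. \<exists>h\<in>hom \<Omega> (product_algebra \<Omega> I B) D. h x \<noteq> h y"
    using i(2) xy(1,2) by (intro bexI[OF _ X[OF i(1)]] bexI[OF _ hom_projection[OF B i(1)]]) simp_all
qed

lemma hom_subalgebra_incl: "subalgebra \<Omega> C B \<Longrightarrow> (\<lambda>c\<in>carrier C. c) \<in> hom \<Omega> C B"
  by (rule iffD1[OF hom_subalgebra_iff, THEN conjunct1], assumption, rule hom_id, rule subalgebra_is_algebra)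

lemma inj_on_tuple:
  assumes "\<And>a b. a \<in> S \<Longrightarrow> b \<in> S \<Longrightarrow> \<forall>i\<in>I. h i a = h i b \<Longrightarrow> a = b"
  shows "inj_on (\<lambda>a\<in>S. \<lambda>i\<in>I. h i a) S"
proof (rule inj_onI)
  fix a b assume ab: "a \<in> S" "b \<in> S" and "(\<lambda>a\<in>S. \<lambda>i\<in>I. h i a) a = (\<lambda>a\<in>S. \<lambda>i\<in>I. h i a) b"
  then have eq: "(\<lambda>i\<in>I. h i a) = (\<lambda>i\<in>I. h i b)"
    by simp
  have "h i a = h i b" if "i \<in> I" for i
    using fun_cong[OF eq, of i] that by simp
  then show "a = b"
    using assms ab by blast
qed

text \<open>One separating homomorphism is chosen for each pair of distinct elements, so the family
  is no larger than the square of the carrier, even if \<open>X\<close> is a proper class. The pairs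
  are then recoded in \<open>'u\<close>, where \<open>P_closure\<close> expects its index
  sets.\<close>

lemma separating_family:
  fixes A :: "('f, 'r, 'a) algebra" and X :: "('f, 'r, 'b) algebra set"
  assumes U: "universe TYPE('u)" and sm: "small TYPE('u) (carrier A)" and A: "separated \<Omega> X A"
  obtains I :: "'u set" and B h where
    "small TYPE('u) I" "\<And>i. i \<in> I \<Longrightarrow> B i \<in> X" "\<And>i. i \<in> I \<Longrightarrow> h i \<in> hom \<Omega> A (B i)"
    "inj_on (\<lambda>a\<in>carrier A. \<lambda>i\<in>I. h i a) (carrier A)"
proof -
  define J where "J = {(a, b) \<in> carrier A \<times> carrier A. a \<noteq> b}"
  have "small TYPE('u) (carrier A \<times> carrier A)"
    by (rule small_Sigma[OF U sm sm])
  then have J: "small TYPE('u) J"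
    by (rule small_subset) (auto simp: J_def)
  then obtain e :: "_ \<Rightarrow> 'u" where e: "inj_on e J"
    by (rule small_embedding)
  have "\<forall>j\<in>J. \<exists>B h. B \<in> X \<and> h \<in> hom \<Omega> A B \<and> h (fst j) \<noteq> h (snd j)"
  proof
    show "\<exists>B h. B \<in> X \<and> h \<in> hom \<Omega> A B \<and> h (fst j) \<noteq> h (snd j)" if "j \<in> J" for j
    proof -
      have "fst j \<in> carrier A" "snd j \<in> carrier A" "fst j \<noteq> snd j"
        using that unfolding J_def by auto
      then show ?thesis
        using separatedE[OF A] by blast
    qed
  qed
  then obtain B h where Bh: "B j \<in> X" "h j \<in> hom \<Omega> A (B j)" "h j (fst j) \<noteq> h j (snd j)" if "j \<in> J" for j
    by metis
  let ?d = "inv_into J e"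
  have inj: "a = b"
    if ab: "a \<in> carrier A" "b \<in> carrier A" and eq: "\<forall>i\<in>e ` J. h (?d i) a = h (?d i) b" for a b
  proof (rule ccontr)
    assume "a \<noteq> b"
    then have j: "(a, b) \<in> J"
      using ab unfolding J_def by simp
    then show False
      using bspec[OF eq imageI[OF j]] Bh(3)[OF j] by (simp add: inv_into_f_f[OF e])
  qed
  show ?thesis
  proof (rule that[of "e ` J" "\<lambda>i. B (?d i)" "\<lambda>i. h (?d i)"])
    show "small TYPE('u) (e ` J)"
      using J by (rule small_image)
    show "inj_on (\<lambda>a\<in>carrier A. \<lambda>i\<in>e ` J. h (?d i) a) (carrier A)"
      using inj by (rule inj_on_tuple)
  qed (use Bh(1,2)[OF inv_into_into[of _ e J]] in simp_all)
qed

text \<open>From left to right, projections separate a product, and separation is inherited along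
  each embedding. From right to left, a small separating family embeds \<open>A\<close> in a product
  of members of \<open>X\<close>, whose copy over \<open>'u\<close> lies in
  \<open>P_closure \<Omega> X\<close>. \<open>X\<close> may be a proper class, which later permits
  taking \<open>P\<close> itself for \<open>X\<close>.\<close>

lemma prevariety_generated_iff:
  fixes X :: "('f, 'r, 'u) algebra set"
  assumes U: "universe TYPE('u)" and X: "X \<subseteq> Alg \<Omega>"
  shows "A \<in> prevariety_generated \<Omega> X \<longleftrightarrow> A \<in> Alg \<Omega> \<and> separated \<Omega> X A"
proof
  assume "A \<in> prevariety_generated \<Omega> X"
  then obtain D C where A: "A \<in> Alg \<Omega>" and D: "D \<in> P_closure \<Omega> X" and C: "subalgebra \<Omega> C D"
    and "isomorphic \<Omega> A C"
    unfolding prevariety_generated_def S_closure_def by blast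
  then obtain h where h: "h \<in> iso \<Omega> A C"
    unfolding isomorphic_def by blast
  obtain I :: "'u set" and B k where B: "\<And>i. i \<in> I \<Longrightarrow> B i \<in> X" and k: "k \<in> iso \<Omega> D (product_algebra \<Omega> I B)"
    using D unfolding P_closure_def isomorphic_def by blast
  have B': "is_algebra \<Omega> (B i)" if "i \<in> I" for i
    using B[OF that] X Alg_is_algebra by blast
  have D': "is_algebra \<Omega> D"
    using D Alg_is_algebra unfolding P_closure_def by blast
  have "separated \<Omega> X D"
    using separated_hom[OF D' iso_hom[OF k] iso_inj[OF k] separated_product[OF B' B]] .
  then have "separated \<Omega> X C"
    by (rule separated_hom[OF subalgebra_is_algebra[OF C] hom_subalgebra_incl[OF C], rotated]) simp
  then show "A \<in> Alg \<Omega> \<and> separated \<Omega> X A"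
    using A separated_hom[OF Alg_is_algebra[OF A] iso_hom[OF h] iso_inj[OF h]] by blast
next
  assume "A \<in> Alg \<Omega> \<and> separated \<Omega> X A"
  then have A: "A \<in> Alg \<Omega>" "is_algebra \<Omega> A" "small TYPE('u) (carrier A)" and sep: "separated \<Omega> X A"
    unfolding Alg_def by blast+
  obtain I :: "'u set" and B h where I: "small TYPE('u) I" and B: "\<And>i. i \<in> I \<Longrightarrow> B i \<in> X"
    and h: "\<And>i. i \<in> I \<Longrightarrow> h i \<in> hom \<Omega> A (B i)"
    and inj: "inj_on (\<lambda>a\<in>carrier A. \<lambda>i\<in>I. h i a) (carrier A)"
    using separating_family[OF U A(3) sep] by blast
  have B': "is_algebra \<Omega> (B i)" "small TYPE('u) (carrier (B i))" if "i \<in> I" for i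
    using B[OF that] X unfolding Alg_def by blast+
  let ?P = "product_algebra \<Omega> I B" and ?t = "\<lambda>a\<in>carrier A. \<lambda>i\<in>I. h i a"
  have t: "?t \<in> hom \<Omega> A ?P"
    using A(2) h by (rule hom_tuple)
  have P: "is_algebra \<Omega> ?P"
    using B'(1) by (rule product_is_algebra)
  obtain D :: "('f, 'r, 'u) algebra" and k where D: "D \<in> Alg \<Omega>" and k: "k \<in> iso \<Omega> ?P D"
    using transport[OF P product_small[OF U I B'(2)]] by blast
  have "isomorphic \<Omega> D ?P"
    using iso_sym[OF P Alg_is_algebra[OF D] k] unfolding isomorphic_def by blast
  then have "D \<in> P_closure \<Omega> X"
    using D I B unfolding P_closure_def by blast
  let ?u = "compose (carrier A) k ?t"
  have u: "?u \<in> hom \<Omega> A D"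
    using hom_compose[OF A(2) t iso_hom[OF k]] .
  have "inj_on ?u (carrier A)"
    by (rule inj_on_hom_compose[OF t inj iso_inj[OF k]])
  then have "isomorphic \<Omega> A (image_algebra \<Omega> ?u A D)"
    using iso_image_algebra[OF A(2) u] unfolding isomorphic_def by blast
  with \<open>D \<in> P_closure \<Omega> X\<close> image_subalgebra[OF A(2) u] A(1) show "A \<in> prevariety_generated \<Omega> X"
    unfolding prevariety_generated_def S_closure_def by blast
qed

lemma subset_prevariety_generated:
  fixes X :: "('f, 'r, 'u) algebra set"
  assumes U: "universe TYPE('u)" and X: "X \<subseteq> Alg \<Omega>"
  shows "X \<subseteq> prevariety_generated \<Omega> X"
proof
  fix A assume A: "A \<in> X"
  with X have "A \<in> Alg \<Omega>"
    by blast
  then show "A \<in> prevariety_generated \<Omega> X"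
    using separated_self[OF Alg_is_algebra A] unfolding prevariety_generated_iff[OF U X] by simp
qed

lemma prevariety_iff:
  fixes P :: "('f, 'r, 'u) algebra set"
  assumes U: "universe TYPE('u)" and P: "prevariety \<Omega> P"
  shows "A \<in> P \<longleftrightarrow> A \<in> Alg \<Omega> \<and> separated \<Omega> P A"
proof
  show "A \<in> Alg \<Omega> \<and> separated \<Omega> P A" if "A \<in> P"
    using P that separated_self Alg_is_algebra unfolding prevariety_def by blast
next
  assume "A \<in> Alg \<Omega> \<and> separated \<Omega> P A"
  then have "A \<in> prevariety_generated \<Omega> P"
    using prevariety_generated_iff[OF U] P unfolding prevariety_def by blast
  then show "A \<in> P"
    using P unfolding prevariety_def prevariety_generated_def S_closure_def by blast
qed

lemma prevariety_Alg: "prevariety \<Omega> P \<Longrightarrow> A \<in> P \<Longrightarrow> A \<in> Alg \<Omega>"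
  unfolding prevariety_def by blast

lemma prevariety_is_algebra: "prevariety \<Omega> P \<Longrightarrow> A \<in> P \<Longrightarrow> is_algebra \<Omega> A"
  by (rule Alg_is_algebra, rule prevariety_Alg)

lemma prevariety_small: "prevariety \<Omega> P \<Longrightarrow> A \<in> P \<Longrightarrow> small TYPE('u) (carrier (A :: ('f, 'r, 'u) algebra))"
  using prevariety_Alg unfolding Alg_def by blast

text \<open>A homomorphic image of a member need not lie in a prevariety, but this image is a
  subalgebra of \<open>B\<close> and inherits separation by \<open>P\<close> from it.\<close>

lemma prevariety_image:
  fixes P :: "('f, 'r, 'u) algebra set"
  assumes U: "universe TYPE('u)" and P: "prevariety \<Omega> P"
    and A: "is_algebra \<Omega> A" and h: "h \<in> hom \<Omega> A B" and B: "B \<in> P"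
  shows "image_algebra \<Omega> h A B \<in> P"
proof -
  let ?C = "image_algebra \<Omega> h A B"
  note C = image_subalgebra[OF A h]
  have "separated \<Omega> P ?C"
    using prevariety_iff[OF U P, of B] B
    by (intro separated_hom[OF subalgebra_is_algebra[OF C] hom_subalgebra_incl[OF C]]) auto
  moreover have "small TYPE('u) (carrier ?C)"
    using small_subset[OF prevariety_small[OF P B] subalgebra_carrier[OF C]] .
  ultimately show ?thesis
    using subalgebra_is_algebra[OF C] unfolding prevariety_iff[OF U P] Alg_def by blast
qed

section \<open>Subdirectly irreducible algebras\<close>

text \<open>Cutting each target of a separating family down to the image of \<open>A\<close> makes
  the embedding in the product subdirect. Irreducibility then turns one projection into an
  isomorphism, so the homomorphism \<open>h i\<close> at that coordinate is injective.\<close>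

lemma subdirectly_irreducible_embeds:
  fixes P :: "('f, 'r, 'u) algebra set"
  assumes U: "universe TYPE('u)" and P: "prevariety \<Omega> P" and G: "G \<subseteq> P"
    and A: "subdirectly_irreducible \<Omega> P A" and sep: "separated \<Omega> G A"
  obtains B h where "B \<in> G" "h \<in> hom \<Omega> A B" "inj_on h (carrier A)"
proof -
  have AP: "A \<in> P"
    using A unfolding subdirectly_irreducible_def by blast
  note A' = prevariety_is_algebra[OF P AP]
  obtain I :: "'u set" and B h where I: "small TYPE('u) I" and B: "\<And>i. i \<in> I \<Longrightarrow> B i \<in> G"
    and h: "\<And>i. i \<in> I \<Longrightarrow> h i \<in> hom \<Omega> A (B i)"
    and inj: "inj_on (\<lambda>a\<in>carrier A. \<lambda>i\<in>I. h i a) (carrier A)"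
    using separating_family[OF U prevariety_small[OF P AP] sep] by blast
  let ?B = "\<lambda>i. image_algebra \<Omega> (h i) A (B i)"
  let ?t = "\<lambda>a\<in>carrier A. \<lambda>i\<in>I. h i a"
  let ?C = "image_algebra \<Omega> ?t A (product_algebra \<Omega> I ?B)"
  have t: "?t \<in> hom \<Omega> A (product_algebra \<Omega> I ?B)"
    by (intro hom_tuple[OF A'] hom_image[OF A'] h)
  have "(\<lambda>x. x i) ` carrier ?C = carrier (?B i)" if "i \<in> I" for i
    using that by (auto simp: image_image)
  then have "subdirect_product \<Omega> ?C I ?B"
    using image_subalgebra[OF A' t] unfolding subdirect_product_def by blast
  moreover have "isomorphic \<Omega> A ?C"
    using iso_image_algebra[OF A' t inj] unfolding isomorphic_def by blast
  moreover have "\<forall>i\<in>I. ?B i \<in> P"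
    using prevariety_image[OF U P A' h] B G by blast
  ultimately have "\<exists>i\<in>I. (\<lambda>x\<in>carrier ?C. x i) \<in> iso \<Omega> ?C (?B i)"
    using A[unfolded subdirectly_irreducible_def, THEN conjunct2, rule_format, of I ?B ?C] I by simp
  then obtain i where i: "i \<in> I" "(\<lambda>x\<in>carrier ?C. x i) \<in> iso \<Omega> ?C (?B i)"
    by blast
  have "inj_on (h i) (carrier A)"
  proof (rule inj_onI)
    fix a b assume ab: "a \<in> carrier A" "b \<in> carrier A" "h i a = h i b"
    then have "(\<lambda>x\<in>carrier ?C. x i) (?t a) = (\<lambda>x\<in>carrier ?C. x i) (?t b)"
      using i(1) by simp
    then have "?t a = ?t b"
      using ab by (intro inj_onD[OF iso_inj[OF i(2)]]) (simp_all only: algebra.simps imageI)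
    then show "a = b"
      using inj_onD[OF inj] ab by blast
  qed
  with B h i(1) that show ?thesis
    by blast
qed

text \<open>The pair \<open>a\<close>, \<open>b\<close> plays the part of a generator of the
  monolith: in any subdirect decomposition some coordinate separates it, and that projection is
  injective by assumption and surjective by subdirectness.\<close>

lemma subdirectly_irreducibleI:
  fixes P :: "('f, 'r, 'u) algebra set"
  assumes A: "A \<in> P" and ab: "a \<in> carrier A" "b \<in> carrier A" "a \<noteq> b"
    and inj: "\<And>B h. B \<in> P \<Longrightarrow> h \<in> hom \<Omega> A B \<Longrightarrow> h a \<noteq> h b \<Longrightarrow> inj_on h (carrier A)"
    and P: "prevariety \<Omega> P"
  shows "subdirectly_irreducible \<Omega> P A"
  unfolding subdirectly_irreducible_def
proof (intro conjI A allI impI)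
  fix I :: "'u set" and B :: "'u \<Rightarrow> ('f, 'r, 'u) algebra" and C
  assume "small TYPE('u) I \<and> (\<forall>i\<in>I. B i \<in> P) \<and> subdirect_product \<Omega> C I B \<and> isomorphic \<Omega> A C"
  then have B: "\<And>i. i \<in> I \<Longrightarrow> B i \<in> P" and C: "subalgebra \<Omega> C (product_algebra \<Omega> I B)"
    and surj: "\<And>i. i \<in> I \<Longrightarrow> (\<lambda>x. x i) ` carrier C = carrier (B i)" and "isomorphic \<Omega> A C"
    unfolding subdirect_product_def by simp_all
  then obtain k where k: "k \<in> iso \<Omega> A C"
    unfolding isomorphic_def by auto
  let ?p = "\<lambda>i. \<lambda>x\<in>carrier C. x i"
  have C_sub: "carrier C \<subseteq> (\<Pi>\<^sub>E i\<in>I. carrier (B i))"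
    using subalgebra_carrier[OF C] unfolding product_carrier .
  have "k a \<noteq> k b"
    using inj_onD[OF iso_inj[OF k] _ ab(1,2)] ab(3) by blast
  moreover have ka: "k a \<in> carrier C" "k b \<in> carrier C"
    using hom_mem[OF iso_hom[OF k]] ab by blast+
  ultimately obtain i where i: "i \<in> I" "k a i \<noteq> k b i"
    using C_sub PiE_ext[of "k a" I _ "k b"] by blast
  have p: "?p i \<in> hom \<Omega> C (B i)"
  proof -
    have "compose (carrier C) (\<lambda>x\<in>carrier (product_algebra \<Omega> I B). x i) (\<lambda>x\<in>carrier C. x) = ?p i"
      unfolding compose_def using subalgebra_carrier[OF C] by (intro restrict_ext) auto
    with hom_compose[OF subalgebra_is_algebra[OF C] hom_subalgebra_incl[OF C]
        hom_projection[OF prevariety_is_algebra[OF P B] i(1)]]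
    show ?thesis
      by simp
  qed
  have "inj_on (compose (carrier A) (?p i) k) (carrier A)"
  proof (rule inj[OF B[OF i(1)]])
    show "compose (carrier A) (?p i) k \<in> hom \<Omega> A (B i)"
      by (rule hom_compose[OF prevariety_is_algebra[OF P A] iso_hom[OF k] p])
    show "compose (carrier A) (?p i) k a \<noteq> compose (carrier A) (?p i) k b"
      using i(2) ab ka by (simp add: compose_def)
  qed
  then have "inj_on (?p i \<circ> k) (carrier A)"
    by (simp add: compose_def inj_on_def)
  then have "inj_on (?p i) (carrier C)"
    using inj_on_imageI[of "?p i" k "carrier A"] iso_image[OF k] by simp
  moreover have "?p i ` carrier C = carrier (B i)"
    using surj[OF i(1)] by simp
  ultimately show "\<exists>i\<in>I. ?p i \<in> iso \<Omega> C (B i)"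
    using isoI[OF p] i(1) by blast
qed

section \<open>Coproducts\<close>

text \<open>The condition on \<open>x\<close> is membership in \<open>arity \<Omega> f
  \<rightarrow>\<^sub>E generated \<Omega> A S\<close>, split up so that the recursive occurrence is
  plainly monotone. With infinite arities the rule branches infinitely, and closing off in \<omega>
  steps would not suffice.\<close>

inductive_set generated :: "('f, 'r) signature \<Rightarrow> ('f, 'r, 'a) algebra \<Rightarrow> 'a set \<Rightarrow> 'a set"
  for \<Omega> A S where
    base: "s \<in> S \<Longrightarrow> s \<in> generated \<Omega> A S"
  | step: "f \<in> ops \<Omega> \<Longrightarrow> x \<in> extensional (arity \<Omega> f) \<Longrightarrow> \<forall>r\<in>arity \<Omega> f. x r \<in> generated \<Omega> A S \<Longrightarrow>
      oper A f x \<in> generated \<Omega> A S"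

abbreviation generated_algebra ::
  "('f, 'r) signature \<Rightarrow> ('f, 'r, 'a) algebra \<Rightarrow> 'a set \<Rightarrow> ('f, 'r, 'a) algebra" where
  "generated_algebra \<Omega> A S \<equiv> mk_algebra \<Omega> (generated \<Omega> A S) (oper A)"

lemma generated_subset:
  assumes S: "S \<subseteq> T" and T: "\<And>f x. f \<in> ops \<Omega> \<Longrightarrow> x \<in> arity \<Omega> f \<rightarrow>\<^sub>E T \<Longrightarrow> oper A f x \<in> T"
  shows "generated \<Omega> A S \<subseteq> T"
proof
  show "z \<in> T" if "z \<in> generated \<Omega> A S" for z
    using that by induction (use S T in \<open>auto simp: PiE_iff\<close>)
qed

lemma generated_subalgebra:
  assumes "is_algebra \<Omega> A" and "S \<subseteq> carrier A"
  shows "subalgebra \<Omega> (generated_algebra \<Omega> A S) A"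
  using generated_subset[of S "carrier A" \<Omega> A] assms oper_closed[OF assms(1)] generated.step
  by (intro subalgebra_mk) (auto simp: PiE_iff)

text \<open>The equalizer of \<open>h\<close> and \<open>k\<close> contains \<open>S\<close> and is
  closed under the operations, so it is everything.\<close>

lemma hom_generated_ext:
  assumes A: "is_algebra \<Omega> A" and S: "S \<subseteq> carrier A"
    and h: "h \<in> hom \<Omega> (generated_algebra \<Omega> A S) B" and k: "k \<in> hom \<Omega> (generated_algebra \<Omega> A S) B"
    and eq: "\<And>s. s \<in> S \<Longrightarrow> h s = k s"
  shows "h = k"
proof (rule hom_ext[OF h k])
  let ?T = "{z \<in> generated \<Omega> A S. h z = k z}"
  have "generated \<Omega> A S \<subseteq> ?T"
  proof (rule generated_subset)
    show "S \<subseteq> ?T"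
      using eq by (auto intro: generated.base)
    fix f x assume f: "f \<in> ops \<Omega>" and x: "x \<in> arity \<Omega> f \<rightarrow>\<^sub>E ?T"
    have x': "x \<in> arity \<Omega> f \<rightarrow>\<^sub>E generated \<Omega> A S"
      using x by (simp add: PiE_iff)
    have "(\<lambda>r\<in>arity \<Omega> f. h (x r)) = (\<lambda>r\<in>arity \<Omega> f. k (x r))"
      using PiE_mem[OF x] by (intro restrict_ext) simp
    then have "h (oper A f x) = k (oper A f x)"
      using hom_oper[OF h f] hom_oper[OF k f] x' f by simp
    moreover have "oper A f x \<in> generated \<Omega> A S"
      using x' by (intro generated.step[OF f]) (simp_all add: PiE_iff)
    ultimately show "oper A f x \<in> ?T"
      by simp
  qed
  then show "h a = k a" if "a \<in> carrier (generated_algebra \<Omega> A S)" for a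
    using that by auto
qed

text \<open>
  The coproduct is generated by the images of the members of \<open>X\<close> in the product of all cocones
  from \<open>X\<close> to generating algebras. A cocone to an arbitrary \<open>D\<close> factors through it because \<open>D\<close>
  embeds in a product of generating algebras.
\<close>

lemma coproduct_exists:
  fixes P :: "('f, 'r, 'u) algebra set"
  assumes U: "universe TYPE('u)" and G: "G \<subseteq> Alg \<Omega>" "small TYPE('u) G"
    and P: "P = prevariety_generated \<Omega> G"
    and X: "X \<subseteq> P" "small TYPE('u) X"
  obtains C q where "is_coproduct \<Omega> P X C q"
proof -
  have P_iff: "A \<in> P \<longleftrightarrow> A \<in> Alg \<Omega> \<and> separated \<Omega> G A" for A
    unfolding P by (rule prevariety_generated_iff[OF U G(1)])
  have G_alg: "is_algebra \<Omega> B" "small TYPE('u) (carrier B)" if "B \<in> G" for B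
    using subsetD[OF G(1) that] unfolding Alg_def by simp_all
  have X_alg: "is_algebra \<Omega> A" "small TYPE('u) (carrier A)" if "A \<in> X" for A
    using subsetD[OF X(1) that] unfolding P_iff Alg_def by simp_all
  \<comment> \<open>An index is a member of \<open>G\<close> together with a homomorphism to it from
    each member of \<open>X\<close>; as \<open>G\<close> and \<open>X\<close> are small, these
    cocones form a set.\<close>
  define J where "J = (SIGMA B:G. \<Pi>\<^sub>E A\<in>X. hom \<Omega> A B)"
  have "small TYPE('u) (hom \<Omega> A B)" if "A \<in> X" "B \<in> G" for A B
    by (rule small_subset[OF small_PiE[OF U X_alg(2)[OF that(1)] G_alg(2)[OF that(2)]]])
      (auto simp: hom_def)
  then have J: "small TYPE('u) J"
    unfolding J_def by (intro small_Sigma[OF U] small_PiE[OF U] G X)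
  define Q where "Q = product_algebra \<Omega> J fst"
  have J_alg: "fst j \<in> G" "is_algebra \<Omega> (fst j)" "small TYPE('u) (carrier (fst j))" if "j \<in> J" for j
    using that G_alg unfolding J_def by auto
  have Q: "is_algebra \<Omega> Q" "separated \<Omega> G Q" "small TYPE('u) (carrier Q)"
    unfolding Q_def
    by (intro product_is_algebra separated_product product_small U J J_alg; assumption)+
  define p where "p A = (\<lambda>a\<in>carrier A. \<lambda>j\<in>J. snd j A a)" for A
  have p: "p A \<in> hom \<Omega> A Q" if "A \<in> X" for A
    unfolding p_def Q_def
    by (rule hom_tuple) (use that X_alg in \<open>auto simp: J_def\<close>)
  define S where "S = (\<Union>A\<in>X. p A ` carrier A)"
  have S: "S \<subseteq> carrier Q"
    using hom_mem[OF p] unfolding S_def by blast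
  define C0 where "C0 = generated_algebra \<Omega> Q S"
  have C0: "subalgebra \<Omega> C0 Q"
    unfolding C0_def using Q(1) S by (rule generated_subalgebra)
  note C0_alg = subalgebra_is_algebra[OF C0]
  have pC0: "p A \<in> hom \<Omega> A C0" if "A \<in> X" for A
    using p[OF that] that unfolding hom_subalgebra_iff[OF C0]
    by (auto simp: C0_def S_def intro: generated.base)
  have "small TYPE('u) (carrier C0)"
    using Q(3) subalgebra_carrier[OF C0] by (rule small_subset)
  then obtain C :: "('f, 'r, 'u) algebra" and \<phi> where C: "C \<in> Alg \<Omega>" and \<phi>: "\<phi> \<in> iso \<Omega> C0 C"
    using transport[OF C0_alg] by blast
  note C_alg = Alg_is_algebra[OF C]
  define \<psi> where "\<psi> = restrict (inv_into (carrier C0) \<phi>) (carrier C)"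
  have \<psi>: "\<psi> \<in> iso \<Omega> C C0"
    unfolding \<psi>_def using C0_alg C_alg \<phi> by (rule iso_sym)
  have \<psi>\<phi>: "\<psi> (\<phi> c) = c" if "c \<in> carrier C0" for c
    unfolding \<psi>_def using that hom_mem[OF iso_hom[OF \<phi>] that] inv_into_f_f[OF iso_inj[OF \<phi>] that] by simp
  have "separated \<Omega> G C0"
    by (rule separated_hom[OF C0_alg hom_subalgebra_incl[OF C0] _ Q(2)]) simp
  then have "separated \<Omega> G C"
    by (rule separated_hom[OF C_alg iso_hom[OF \<psi>] iso_inj[OF \<psi>]])
  with C have "C \<in> P"
    unfolding P_iff ..
  define q where "q A = compose (carrier A) \<phi> (p A)" for A
  have q: "q A \<in> hom \<Omega> A C" if "A \<in> X" for A
    unfolding q_def by (rule hom_compose[OF X_alg(1)[OF that] pC0[OF that] iso_hom[OF \<phi>]])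
  have "\<exists>!h. h \<in> hom \<Omega> C D \<and> (\<forall>A\<in>X. compose (carrier A) h (q A) = g A)"
    if D: "D \<in> P" and g: "\<forall>A\<in>X. g A \<in> hom \<Omega> A D" for D g
  proof (rule ex_ex1I)
    have D_alg: "is_algebra \<Omega> D" "small TYPE('u) (carrier D)" "separated \<Omega> G D"
      using D unfolding P_iff Alg_def by blast+
    obtain I :: "'u set" and E u where "small TYPE('u) I" and E: "\<And>i. i \<in> I \<Longrightarrow> E i \<in> G"
      and u: "\<And>i. i \<in> I \<Longrightarrow> u i \<in> hom \<Omega> D (E i)"
      and inj: "inj_on (\<lambda>d\<in>carrier D. \<lambda>i\<in>I. u i d) (carrier D)"
      using separating_family[OF U D_alg(2,3)] by blast
    let ?R = "product_algebra \<Omega> I E"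
    define t where "t = (\<lambda>d\<in>carrier D. \<lambda>i\<in>I. u i d)"
    have t: "t \<in> hom \<Omega> D ?R"
      unfolding t_def using D_alg(1) u by (rule hom_tuple)
    have t_inj: "inj_on t (carrier D)"
      unfolding t_def by (rule inj)
    \<comment> \<open>The cocone \<open>g\<close> followed by the coordinate \<open>u i\<close> ends
      in a generator, so it is one of the indices in \<open>J\<close>; \<open>w\<close> below reads
      off just these coordinates of \<open>Q\<close>.\<close>
    define j where "j i = (E i, \<lambda>A\<in>X. compose (carrier A) (u i) (g A))" for i
    have j: "j i \<in> J" if "i \<in> I" for i
      unfolding j_def J_def using E[OF that] hom_compose[OF X_alg(1) bspec[OF g] u[OF that]] by auto
    define w where "w = (\<lambda>x\<in>carrier Q. \<lambda>i\<in>I. (\<lambda>x\<in>carrier Q. x (j i)) x)"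
    have w: "w \<in> hom \<Omega> Q ?R"
      unfolding w_def
    proof (rule hom_tuple[OF Q(1)])
      show "(\<lambda>x\<in>carrier Q. x (j i)) \<in> hom \<Omega> Q (E i)" if "i \<in> I" for i
        using hom_projection[of J \<Omega> fst, OF J_alg(2) j[OF that]] unfolding Q_def by (simp add: j_def)
    qed
    have wp: "w (p A a) = t (g A a)" if "A \<in> X" "a \<in> carrier A" for A a
    proof -
      note mem = hom_mem[OF bspec[OF g that(1)] that(2)] hom_mem[OF p[OF that(1)] that(2)]
      have "p A a (j i) = u i (g A a)" if "i \<in> I" for i
        using j[OF that] \<open>A \<in> X\<close> \<open>a \<in> carrier A\<close> by (simp add: p_def j_def compose_eq)
      then have "(\<lambda>i\<in>I. p A a (j i)) = (\<lambda>i\<in>I. u i (g A a))"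
        by (rule restrict_ext)
      with mem show ?thesis
        unfolding w_def t_def by simp
    qed
    let ?D = "image_algebra \<Omega> t D ?R"
    note tD = image_subalgebra[OF D_alg(1) t]
    \<comment> \<open>On \<open>S\<close> the map \<open>w\<close> lands in the image of
      \<open>D\<close> under \<open>t\<close>, and the preimage of a subalgebra is closed under the
      operations, so all of \<open>C0\<close> lands there. This permits following \<open>w\<close>
      by the inverse of \<open>t\<close>.\<close>
    have "carrier C0 \<subseteq> {x \<in> carrier Q. w x \<in> carrier ?D}"
      unfolding C0_def algebra.simps
    proof (rule generated_subset)
      show "S \<subseteq> {x \<in> carrier Q. w x \<in> t ` carrier D}"
      proof
        fix s assume "s \<in> S"
        then obtain A a where A: "A \<in> X" "a \<in> carrier A" "s = p A a"
          unfolding S_def by blast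
        have "w s \<in> t ` carrier D"
          unfolding A(3) wp[OF A(1,2)] using hom_mem[OF bspec[OF g A(1)] A(2)] by (rule imageI)
        with S \<open>s \<in> S\<close> show "s \<in> {x \<in> carrier Q. w x \<in> t ` carrier D}"
          by blast
      qed
      fix f x assume f: "f \<in> ops \<Omega>" and x: "x \<in> arity \<Omega> f \<rightarrow>\<^sub>E {x \<in> carrier Q. w x \<in> t ` carrier D}"
      have x': "x \<in> arity \<Omega> f \<rightarrow>\<^sub>E carrier Q"
        using x by (simp add: PiE_iff)
      have wx: "(\<lambda>r\<in>arity \<Omega> f. w (x r)) \<in> arity \<Omega> f \<rightarrow>\<^sub>E carrier ?D"
        using PiE_mem[OF x] by simp
      have "w (oper Q f x) = oper ?D f (\<lambda>r\<in>arity \<Omega> f. w (x r))"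
        using hom_oper[OF w f x'] subalgebra_oper[OF tD f wx] by simp
      then have "w (oper Q f x) \<in> carrier ?D"
        using oper_closed[OF subalgebra_is_algebra[OF tD] f wx] by simp
      then show "oper Q f x \<in> {x \<in> carrier Q. w x \<in> t ` carrier D}"
        using oper_closed[OF Q(1) f x'] by simp
    qed
    then have w_C0: "restrict w (carrier C0) ` carrier C0 \<subseteq> carrier ?D"
      by auto
    have "compose (carrier C0) w (\<lambda>c\<in>carrier C0. c) = restrict w (carrier C0)"
      unfolding compose_def by (rule restrict_ext) simp
    then have w': "restrict w (carrier C0) \<in> hom \<Omega> C0 ?D"
      using hom_compose[OF C0_alg hom_subalgebra_incl[OF C0] w] w_C0
      unfolding hom_subalgebra_iff[OF tD] by simp
    define t' where "t' = restrict (inv_into (carrier D) t) (carrier ?D)"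
    have t': "t' \<in> iso \<Omega> ?D D"
      unfolding t'_def
      using D_alg(1) subalgebra_is_algebra[OF tD] iso_image_algebra[OF D_alg(1) t t_inj] by (rule iso_sym)
    have t't: "t' (t d) = d" if "d \<in> carrier D" for d
      unfolding t'_def using that by (simp add: inv_into_f_f[OF t_inj])
    define h where "h = compose (carrier C) (compose (carrier C0) t' (restrict w (carrier C0))) \<psi>"
    have h: "h \<in> hom \<Omega> C D"
      unfolding h_def
      by (rule hom_compose[OF C_alg iso_hom[OF \<psi>] hom_compose[OF C0_alg w' iso_hom[OF t']]])
    moreover have "compose (carrier A) h (q A) = g A" if "A \<in> X" for A
    proof (rule hom_ext)
      show "compose (carrier A) h (q A) \<in> hom \<Omega> A D"
        using hom_compose[OF X_alg(1)[OF that] q[OF that] h] .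
      show "g A \<in> hom \<Omega> A D"
        using g that ..
      fix a assume a: "a \<in> carrier A"
      have ga: "g A a \<in> carrier D" and pa: "p A a \<in> carrier C0"
        using hom_mem[OF bspec[OF g that] a] hom_mem[OF pC0[OF that] a] .
      have "compose (carrier A) h (q A) a = t' (w (p A a))"
        using a pa \<psi>\<phi>[OF pa] hom_mem[OF iso_hom[OF \<phi>] pa] by (simp add: compose_eq h_def q_def)
      then show "compose (carrier A) h (q A) a = g A a"
        unfolding wp[OF that a] t't[OF ga] .
    qed
    ultimately show "\<exists>h. h \<in> hom \<Omega> C D \<and> (\<forall>A\<in>X. compose (carrier A) h (q A) = g A)"
      by blast
  next
    fix h h' assume "h \<in> hom \<Omega> C D \<and> (\<forall>A\<in>X. compose (carrier A) h (q A) = g A)"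
      and "h' \<in> hom \<Omega> C D \<and> (\<forall>A\<in>X. compose (carrier A) h' (q A) = g A)"
    then have h: "h \<in> hom \<Omega> C D" "h' \<in> hom \<Omega> C D"
      and eq: "\<And>A. A \<in> X \<Longrightarrow> compose (carrier A) h (q A) = compose (carrier A) h' (q A)"
      by simp_all
    \<comment> \<open>For uniqueness both homomorphisms are pulled back along \<open>\<phi>\<close>
      to \<open>C0\<close>, where agreement on the generating set \<open>S\<close> decides; as
      \<open>\<phi>\<close> is onto \<open>C\<close>, they agree on \<open>C\<close>.\<close>
    have "compose (carrier C0) h \<phi> = compose (carrier C0) h' \<phi>"
    proof (rule hom_generated_ext[OF Q(1) S])
      show "compose (carrier C0) h \<phi> \<in> hom \<Omega> (generated_algebra \<Omega> Q S) D"
        "compose (carrier C0) h' \<phi> \<in> hom \<Omega> (generated_algebra \<Omega> Q S) D"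
        using hom_compose[OF C0_alg iso_hom[OF \<phi>] h(1)] hom_compose[OF C0_alg iso_hom[OF \<phi>] h(2)]
        unfolding C0_def .
      fix s assume "s \<in> S"
      then obtain A a where A: "A \<in> X" "a \<in> carrier A" "s = p A a"
        unfolding S_def by blast
      then show "compose (carrier C0) h \<phi> s = compose (carrier C0) h' \<phi> s"
        using fun_cong[OF eq[OF A(1)], of a] hom_mem[OF pC0[OF A(1)] A(2)]
        by (simp add: compose_def q_def)
    qed
    then have "h (\<phi> c) = h' (\<phi> c)" if "c \<in> carrier C0" for c
      using compose_eq[OF that, of h \<phi>] compose_eq[OF that, of h' \<phi>] by simp
    then show "h = h'"
      by (intro hom_ext[OF h]) (auto simp: iso_image[OF \<phi>, symmetric])
  qed
  then have "is_coproduct \<Omega> P X C q"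
    unfolding is_coproduct_def using \<open>C \<in> P\<close> q by blast
  then show ?thesis
    by (rule that)
qed

text \<open>The embeddings into \<open>B\<close> form a cocone, so each factors as \<open>h\<close>
  after \<open>q A\<close>, and the first factor of an injection is injective. Residual smallness
  secures the coproduct.\<close>

lemma compatibleI:
  fixes P :: "('f, 'r, 'u) algebra set"
  assumes U: "universe TYPE('u)" and P: "prevariety \<Omega> P" "residually_small \<Omega> P"
    and X: "X \<subseteq> P" "small TYPE('u) X" and B: "B \<in> P"
    and embed: "\<And>A. A \<in> X \<Longrightarrow> \<exists>h\<in>hom \<Omega> A B. inj_on h (carrier A)"
  shows "compatible \<Omega> P X"
proof -
  obtain C q where Cq: "is_coproduct \<Omega> P X C q"
    using P(2) coproduct_exists[OF U _ _ _ X] unfolding residually_small_def by blast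
  obtain g where g: "\<And>A. A \<in> X \<Longrightarrow> g A \<in> hom \<Omega> A B" "\<And>A. A \<in> X \<Longrightarrow> inj_on (g A) (carrier A)"
    using embed by metis
  have "\<forall>A\<in>X. g A \<in> hom \<Omega> A B"
    using g(1) by blast
  then have "\<exists>!h. h \<in> hom \<Omega> C B \<and> (\<forall>A\<in>X. compose (carrier A) h (q A) = g A)"
    using Cq B unfolding is_coproduct_def by simp
  then obtain h where h: "\<forall>A\<in>X. compose (carrier A) h (q A) = g A"
    by blast
  have "inj_on (q A) (carrier A)" if "A \<in> X" for A
    using g(2)[OF that] unfolding bspec[OF h that, symmetric] by (simp add: compose_def inj_on_def)
  with X Cq show ?thesis
    unfolding compatible_def by blast
qed

section \<open>Ultraproducts and subdirect representation in quasivarieties\<close>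

abbreviation filter_rel ::
  "('f, 'r) signature \<Rightarrow> 'i set \<Rightarrow> ('i \<Rightarrow> ('f, 'r, 'a) algebra) \<Rightarrow> 'i filter \<Rightarrow> ('i \<Rightarrow> 'a) rel" where
  "filter_rel \<Omega> I B U \<equiv>
     {(x, y). x \<in> carrier (product_algebra \<Omega> I B) \<and> y \<in> carrier (product_algebra \<Omega> I B) \<and>
        eventually (\<lambda>i. x i = y i) U}"

lemma equiv_filter_rel: "equiv (carrier (product_algebra \<Omega> I B)) (filter_rel \<Omega> I B U)"
proof (rule equivI)
  show "sym (filter_rel \<Omega> I B U)"
    by (rule symI) (simp add: eq_commute)
  show "trans (filter_rel \<Omega> I B U)"
    by (rule transI) (auto elim: eventually_elim2)
qed (auto simp: refl_on_def)

text \<open>Finite arity is decisive: each argument gives agreement of \<open>x\<close> and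
  \<open>y\<close> almost everywhere, and a filter allows finitely many such conditions to be
  combined.\<close>

lemma filter_rel_oper:
  assumes fin: "finitary \<Omega>" and B: "\<And>i. i \<in> I \<Longrightarrow> is_algebra \<Omega> (B i)" and f: "f \<in> ops \<Omega>"
    and x: "x \<in> arity \<Omega> f \<rightarrow>\<^sub>E carrier (product_algebra \<Omega> I B)"
    and y: "y \<in> arity \<Omega> f \<rightarrow>\<^sub>E carrier (product_algebra \<Omega> I B)"
    and xy: "\<And>r. r \<in> arity \<Omega> f \<Longrightarrow> (x r, y r) \<in> filter_rel \<Omega> I B U"
  shows "(oper (product_algebra \<Omega> I B) f x, oper (product_algebra \<Omega> I B) f y) \<in> filter_rel \<Omega> I B U"
proof -
  have "eventually (\<lambda>i. \<forall>r\<in>arity \<Omega> f. x r i = y r i) U"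
    using fin f xy unfolding finitary_def by (intro eventually_ball_finite) auto
  then have "eventually (\<lambda>i. oper (product_algebra \<Omega> I B) f x i = oper (product_algebra \<Omega> I B) f y i) U"
  proof eventually_elim
    case (elim i)
    then have "(\<lambda>r\<in>arity \<Omega> f. x r i) = (\<lambda>r\<in>arity \<Omega> f. y r i)"
      by (intro restrict_ext) simp
    then show ?case
      using f x y by (simp add: product_mk)
  qed
  moreover note oper_closed[OF product_is_algebra[of I \<Omega> B, OF B] f x]
    oper_closed[OF product_is_algebra[of I \<Omega> B, OF B] f y]
  ultimately show ?thesis
    by simp
qed

lemma ultraproduct_mk:
  "ultraproduct \<Omega> I B U =
     mk_algebra \<Omega> (carrier (product_algebra \<Omega> I B) // filter_rel \<Omega> I B U)
       (\<lambda>f x. filter_rel \<Omega> I B U `` {oper (product_algebra \<Omega> I B) f (\<lambda>r\<in>arity \<Omega> f. SOME a. a \<in> x r)})"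
  unfolding ultraproduct_def quotient_algebra_def ..

lemma some_quotient:
  assumes "equiv S \<theta>" and "c \<in> S // \<theta>"
  shows "(SOME a. a \<in> c) \<in> S" "\<theta> `` {SOME a. a \<in> c} = c"
proof -
  have "(SOME a. a \<in> c) \<in> c"
    using in_quotient_imp_non_empty[OF assms] by (simp add: some_in_eq)
  then show "(SOME a. a \<in> c) \<in> S" "\<theta> `` {SOME a. a \<in> c} = c"
    using in_quotient_imp_subset[OF assms] Image_singleton_iff equiv_class_eq_iff[OF assms(1)] assms(2)
    by (auto elim!: quotientE dest: equiv_class_eq[OF assms(1)])
qed

lemma ultraproduct_is_algebra:
  assumes B: "\<And>i. i \<in> I \<Longrightarrow> is_algebra \<Omega> (B i)"
  shows "is_algebra \<Omega> (ultraproduct \<Omega> I B U)"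
  unfolding ultraproduct_mk
proof (rule is_algebra_mk)
  let ?P = "product_algebra \<Omega> I B"
  fix f x assume f: "f \<in> ops \<Omega>" and x: "x \<in> arity \<Omega> f \<rightarrow>\<^sub>E carrier ?P // filter_rel \<Omega> I B U"
  have "(\<lambda>r\<in>arity \<Omega> f. SOME a. a \<in> x r) \<in> arity \<Omega> f \<rightarrow>\<^sub>E carrier ?P"
    using some_quotient(1)[OF equiv_filter_rel PiE_mem[OF x]] by simp
  then show "filter_rel \<Omega> I B U `` {oper ?P f (\<lambda>r\<in>arity \<Omega> f. SOME a. a \<in> x r)} \<in> carrier ?P // filter_rel \<Omega> I B U"
    by (intro quotientI oper_closed[OF product_is_algebra[of I \<Omega> B, OF B] f])
qed

lemma hom_ultraproduct:
  assumes fin: "finitary \<Omega>" and B: "\<And>i. i \<in> I \<Longrightarrow> is_algebra \<Omega> (B i)"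
  shows "(\<lambda>x\<in>carrier (product_algebra \<Omega> I B). filter_rel \<Omega> I B U `` {x}) \<in>
           hom \<Omega> (product_algebra \<Omega> I B) (ultraproduct \<Omega> I B U)"
proof (rule restrict_homI[OF product_is_algebra[of I \<Omega> B, OF B]])
  let ?P = "product_algebra \<Omega> I B" and ?\<theta> = "filter_rel \<Omega> I B U"
  show "?\<theta> `` {x} \<in> carrier (ultraproduct \<Omega> I B U)" if "x \<in> carrier ?P" for x
    unfolding ultraproduct_mk algebra.simps using that by (rule quotientI)
  fix f x assume f: "f \<in> ops \<Omega>" and x: "x \<in> arity \<Omega> f \<rightarrow>\<^sub>E carrier ?P"
  let ?c = "\<lambda>r\<in>arity \<Omega> f. ?\<theta> `` {x r}"
  \<comment> \<open>The ultraproduct computes with its own choice of representatives, which may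
    differ from \<open>x\<close>; the congruence property makes the two results equivalent.\<close>
  let ?y = "\<lambda>r\<in>arity \<Omega> f. SOME a. a \<in> ?c r"
  have c': "?c \<in> arity \<Omega> f \<rightarrow>\<^sub>E carrier ?P // ?\<theta>"
    unfolding restrict_PiE_iff using quotientI[OF PiE_mem[OF x]] by blast
  note c = PiE_mem[OF c']
  have y: "?y \<in> arity \<Omega> f \<rightarrow>\<^sub>E carrier ?P"
    unfolding restrict_PiE_iff using some_quotient(1)[OF equiv_filter_rel c] by (intro ballI)
  have "(x r, ?y r) \<in> ?\<theta>" if "r \<in> arity \<Omega> f" for r
    using some_quotient(2)[OF equiv_filter_rel c[OF that]] that
    by (intro eq_equiv_class[OF _ equiv_filter_rel PiE_mem[OF y that]]) (simp only: restrict_apply' that)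
  then have "(oper ?P f x, oper ?P f ?y) \<in> ?\<theta>"
    by (intro filter_rel_oper[OF fin _ f x y] B)
  then have "?\<theta> `` {oper ?P f x} = ?\<theta> `` {oper ?P f ?y}"
    by (rule equiv_class_eq[OF equiv_filter_rel])
  also have "\<dots> = oper (ultraproduct \<Omega> I B U) f ?c"
    unfolding ultraproduct_mk algebra.simps restrict_apply'[OF f] restrict_apply'[OF c'] ..
  finally show "?\<theta> `` {oper ?P f x} = oper (ultraproduct \<Omega> I B U) f ?c" .
qed

section \<open>Congruences relative to \<open>P\<close>, and subdirect representation\<close>

definition kernel :: "('f, 'r, 'a) algebra \<Rightarrow> ('a \<Rightarrow> 'b) \<Rightarrow> 'a rel" where
  "kernel A h = {(a, b). a \<in> carrier A \<and> b \<in> carrier A \<and> h a = h b}"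

lemma kernel_compose:
  "(a, b) \<in> kernel A (compose (carrier A) k h) \<longleftrightarrow>
     a \<in> carrier A \<and> b \<in> carrier A \<and> k (h a) = k (h b)"
  unfolding kernel_def by (auto simp: compose_eq)

text \<open>For a prevariety these are the congruences of \<open>A\<close> whose quotient is
  isomorphic to a member of \<open>P\<close>. Collecting relations instead of homomorphisms gives a
  family ordered by inclusion, and one that stays small for small \<open>A\<close> even when
  \<open>P\<close> is a proper class.\<close>

definition kernels ::
  "('f, 'r) signature \<Rightarrow> ('f, 'r, 'b) algebra set \<Rightarrow> ('f, 'r, 'a) algebra \<Rightarrow> 'a rel set" where
  "kernels \<Omega> P A = {kernel A h | h. \<exists>B\<in>P. h \<in> hom \<Omega> A B}"

text \<open>
  The chain itself indexes an ultraproduct of the quotients, along an ultrafilter containing all its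
  final segments. The diagonal map into it identifies two elements iff some member of the chain does.
\<close>

lemma Union_chain_kernels:
  fixes P :: "('f, 'r, 'u) algebra set"
  assumes U: "universe TYPE('u)" and P: "quasivariety \<Omega> P"
    and A: "is_algebra \<Omega> A" "small TYPE('u) (carrier A)"
    and \<C>: "\<C> \<subseteq> kernels \<Omega> P A" "\<C> \<noteq> {}" and chain: "\<And>K L. K \<in> \<C> \<Longrightarrow> L \<in> \<C> \<Longrightarrow> K \<subseteq> L \<or> L \<subseteq> K"
  shows "\<Union>\<C> \<in> kernels \<Omega> P A"
proof -
  have P': "prevariety \<Omega> P" and fin: "finitary \<Omega>"
    using P unfolding quasivariety_def by simp_all
  have "small TYPE('u) (Pow (carrier A \<times> carrier A))"
    by (intro small_Pow[OF U] small_Sigma[OF U] A(2))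
  then have "small TYPE('u) \<C>"
    by (rule small_subset) (use \<C>(1) in \<open>auto simp: kernels_def kernel_def\<close>)
  then obtain e :: "_ \<Rightarrow> 'u" where e: "inj_on e \<C>"
    by (rule small_embedding)
  define I where "I = e ` \<C>"
  have I: "small TYPE('u) I"
    unfolding I_def using \<open>small TYPE('u) \<C>\<close> by (rule small_image)
  define d where "d = inv_into \<C> e"
  have d: "d ` I = \<C>"
    unfolding d_def I_def using inv_into_image_cancel[OF e subset_refl] .
  have "\<forall>i\<in>I. \<exists>h B. d i = kernel A h \<and> B \<in> P \<and> h \<in> hom \<Omega> A B"
    using \<C>(1) d unfolding kernels_def by blast
  then obtain h B where hB: "\<And>i. i \<in> I \<Longrightarrow> d i = kernel A (h i)" "\<And>i. i \<in> I \<Longrightarrow> B i \<in> P"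
    "\<And>i. i \<in> I \<Longrightarrow> h i \<in> hom \<Omega> A (B i)"
    by metis
  \<comment> \<open>\<open>F\<close> is generated by the final segments of the chain. Linearity
    makes them a filter base, and \<open>F\<close> is proper because each \<open>i\<close> lies in
    its own segment.\<close>
  define F where "F = (INF i\<in>I. principal {j \<in> I. d i \<subseteq> d j})"
  have ev_F: "eventually Q F \<longleftrightarrow> (\<exists>i\<in>I. \<forall>j\<in>I. d i \<subseteq> d j \<longrightarrow> Q j)" for Q
    unfolding F_def
  proof (subst eventually_INF_base)
    show "I \<noteq> {}"
      using \<C>(2) unfolding I_def by blast
    fix i j assume "i \<in> I" "j \<in> I"
    then have "d i \<subseteq> d j \<or> d j \<subseteq> d i"
      using chain d by blast
    with \<open>i \<in> I\<close> \<open>j \<in> I\<close>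
    show "\<exists>k\<in>I. principal {l \<in> I. d k \<subseteq> d l} \<le> inf (principal {l \<in> I. d i \<subseteq> d l}) (principal {l \<in> I. d j \<subseteq> d l})"
      by (auto simp: inf_principal)
  qed (auto simp: eventually_principal)
  have "F \<noteq> bot"
    unfolding trivial_limit_def ev_F by auto
  then obtain V where V: "ultrafilter V" "V \<le> F"
    by (rule ultrafilter_below)
  have ev_V: "eventually Q V" if "i \<in> I" "\<And>j. j \<in> I \<Longrightarrow> d i \<subseteq> d j \<Longrightarrow> Q j" for Q i
    using V(2) ev_F[of Q] that unfolding le_filter_def by blast
  have V_I: "eventually (\<lambda>i. i \<in> I) V"
    using \<C>(2) ev_V[of _ "\<lambda>i. i \<in> I"] unfolding I_def by blast
  let ?P = "product_algebra \<Omega> I B" and ?\<theta> = "filter_rel \<Omega> I B V" and ?W = "ultraproduct \<Omega> I B V"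
  let ?t = "\<lambda>a\<in>carrier A. \<lambda>i\<in>I. h i a"
  have B_alg: "is_algebra \<Omega> (B i)" "small TYPE('u) (carrier (B i))" if "i \<in> I" for i
    using prevariety_is_algebra[OF P' hB(2)[OF that]] prevariety_small[OF P' hB(2)[OF that]] .
  have t: "?t \<in> hom \<Omega> A ?P"
    using A(1) hB(3) by (rule hom_tuple)
  define c where "c = compose (carrier A) (\<lambda>x\<in>carrier ?P. ?\<theta> `` {x}) ?t"
  have c: "c \<in> hom \<Omega> A ?W"
    unfolding c_def by (rule hom_compose[OF A(1) t hom_ultraproduct[OF fin B_alg(1)]])
  have c_eq: "c a = c b \<longleftrightarrow> (a, b) \<in> \<Union>\<C>" if ab: "a \<in> carrier A" "b \<in> carrier A" for a b
  proof -
    have d_iff: "(a, b) \<in> d i \<longleftrightarrow> ?t a i = ?t b i" if "i \<in> I" for i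
      using that ab unfolding hB(1)[OF that] kernel_def by simp
    have "c a = c b \<longleftrightarrow> ?\<theta> `` {?t a} = ?\<theta> `` {?t b}"
      using ab hom_mem[OF t] by (simp add: c_def compose_eq)
    also have "\<dots> \<longleftrightarrow> eventually (\<lambda>i. ?t a i = ?t b i) V"
      using eq_equiv_class_iff[OF equiv_filter_rel hom_mem[OF t ab(1)] hom_mem[OF t ab(2)], of V]
        hom_mem[OF t ab(1)] hom_mem[OF t ab(2)] by simp
    \<comment> \<open>Equality almost everywhere yields equality at some index because
      \<open>V\<close> is proper. Conversely, equality at \<open>i\<close> persists at every
      \<open>j\<close> with \<open>d i \<subseteq> d j\<close>, and that final segment belongs to
      \<open>V\<close>.\<close>
    also have "\<dots> \<longleftrightarrow> (\<exists>i\<in>I. (a, b) \<in> d i)"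
    proof
      assume "eventually (\<lambda>i. ?t a i = ?t b i) V"
      with V_I have "eventually (\<lambda>i. i \<in> I \<and> ?t a i = ?t b i) V"
        by (rule eventually_conj)
      moreover have "V \<noteq> bot"
        using V(1) unfolding ultrafilter_def by blast
      ultimately show "\<exists>i\<in>I. (a, b) \<in> d i"
        using eventually_happens'[of V] d_iff by blast
    next
      assume "\<exists>i\<in>I. (a, b) \<in> d i"
      then obtain i where i: "i \<in> I" "(a, b) \<in> d i"
        by blast
      then show "eventually (\<lambda>i. ?t a i = ?t b i) V"
        using d_iff by (intro ev_V[OF i(1)]) blast
    qed
    also have "\<dots> \<longleftrightarrow> (a, b) \<in> \<Union>\<C>"
      unfolding d[symmetric] by blast
    finally show ?thesis .
  qed
  have W: "is_algebra \<Omega> ?W"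
    using B_alg(1) by (rule ultraproduct_is_algebra)
  have "small TYPE('u) ((\<lambda>x. ?\<theta> `` {x}) ` carrier ?P)"
    by (intro small_image product_small U I B_alg(2))
  then have "small TYPE('u) (carrier ?W)"
    by (rule small_subset) (auto simp: ultraproduct_mk elim!: quotientE)
  then obtain D :: "('f, 'r, 'u) algebra" and k where D: "D \<in> Alg \<Omega>" and k: "k \<in> iso \<Omega> ?W D"
    using transport[OF W] by blast
  have "V \<le> principal I"
    using V_I unfolding le_principal .
  moreover have "isomorphic \<Omega> D ?W"
    using iso_sym[OF W Alg_is_algebra[OF D] k] unfolding isomorphic_def by blast
  ultimately have "D \<in> P"
    using P[unfolded quasivariety_def, THEN conjunct2, THEN conjunct2, rule_format, of D I B V] D I hB(2) V(1)
    by blast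
  moreover have "compose (carrier A) k c \<in> hom \<Omega> A D"
    using A(1) c iso_hom[OF k] by (rule hom_compose)
  moreover have "\<Union>\<C> = kernel A (compose (carrier A) k c)"
  proof -
    have "k (c a) = k (c b) \<longleftrightarrow> (a, b) \<in> \<Union>\<C>" if "a \<in> carrier A" "b \<in> carrier A" for a b
      using c_eq[OF that] inj_on_eq_iff[OF iso_inj[OF k] hom_mem[OF c that(1)] hom_mem[OF c that(2)]]
      by simp
    moreover have "a \<in> carrier A \<and> b \<in> carrier A" if "(a, b) \<in> \<Union>\<C>" for a b
      using that \<C>(1) by (auto simp: kernels_def kernel_def)
    ultimately show ?thesis
      unfolding set_eq_iff split_paired_All kernel_compose by blast
  qed
  ultimately show ?thesis
    unfolding kernels_def by blast
qed

text \<open>A relative form of Birkhoff's subdirect representation theorem; the images of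
  \<open>a\<close> and \<open>b\<close> become the critical pair for
  \<open>subdirectly_irreducibleI\<close>.\<close>

lemma subdirectly_irreducible_separates:
  fixes P :: "('f, 'r, 'u) algebra set"
  assumes U: "universe TYPE('u)" and P: "quasivariety \<Omega> P" and A: "A \<in> P"
    and ab: "a \<in> carrier A" "b \<in> carrier A" "a \<noteq> b"
  obtains B h where "subdirectly_irreducible \<Omega> P B" "h \<in> hom \<Omega> A B" "h a \<noteq> h b"
proof -
  have P': "prevariety \<Omega> P"
    using P unfolding quasivariety_def by simp
  note A' = prevariety_is_algebra[OF P' A] prevariety_small[OF P' A]
  let ?\<K> = "{K \<in> kernels \<Omega> P A. (a, b) \<notin> K}"
  have "\<exists>M\<in>?\<K>. \<forall>K\<in>?\<K>. M \<subseteq> K \<longrightarrow> K = M"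
  proof (rule subset_Zorn_nonempty)
    \<comment> \<open>The diagonal is admissible because \<open>A\<close> itself is in
      \<open>P\<close>.\<close>
    have "kernel A (\<lambda>x\<in>carrier A. x) \<in> kernels \<Omega> P A"
      unfolding kernels_def using hom_id[OF A'(1)] A by blast
    moreover have "(a, b) \<notin> kernel A (\<lambda>x\<in>carrier A. x)"
      using ab by (simp add: kernel_def)
    ultimately show "?\<K> \<noteq> {}"
      by blast
  next
    fix \<C> assume \<C>: "\<C> \<noteq> {}" "subset.chain ?\<K> \<C>"
    then have "\<C> \<subseteq> ?\<K>" and "\<And>K L. K \<in> \<C> \<Longrightarrow> L \<in> \<C> \<Longrightarrow> K \<subseteq> L \<or> L \<subseteq> K"
      unfolding subset_chain_def by blast+
    with \<C>(1) show "\<Union>\<C> \<in> ?\<K>"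
      using Union_chain_kernels[OF U P A'] by blast
  qed
  then obtain M where M: "M \<in> kernels \<Omega> P A" "(a, b) \<notin> M"
    and max: "\<And>K. K \<in> kernels \<Omega> P A \<Longrightarrow> (a, b) \<notin> K \<Longrightarrow> M \<subseteq> K \<Longrightarrow> K = M"
    by blast
  then obtain B h where B: "B \<in> P" and h: "h \<in> hom \<Omega> A B" and Mh: "M = kernel A h"
    unfolding kernels_def by blast
  let ?C = "image_algebra \<Omega> h A B"
  have hC: "h \<in> hom \<Omega> A ?C"
    using A'(1) h by (rule hom_image)
  have hab: "h a \<noteq> h b"
    using M(2) ab unfolding Mh kernel_def by simp
  have "subdirectly_irreducible \<Omega> P ?C"
  proof (rule subdirectly_irreducibleI[OF _ _ _ hab _ P'])
    show "?C \<in> P"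
      by (rule prevariety_image[OF U P' A'(1) h B])
    show "h a \<in> carrier ?C" "h b \<in> carrier ?C"
      using ab by simp_all
    fix D g assume D: "D \<in> P" and g: "g \<in> hom \<Omega> ?C D" and gab: "g (h a) \<noteq> g (h b)"
    \<comment> \<open>Pulled back to \<open>A\<close>, the kernel of \<open>g\<close> lies above
      \<open>M\<close> and still omits \<open>(a, b)\<close>; maximality forces equality, so
      \<open>g\<close> identifies nothing new.\<close>
    let ?K = "kernel A (compose (carrier A) g h)"
    have "?K = M"
    proof (rule max)
      show "?K \<in> kernels \<Omega> P A"
        unfolding kernels_def using D hom_compose[OF A'(1) hC g] by blast
      show "(a, b) \<notin> ?K"
        using gab unfolding kernel_compose by simp
      show "M \<subseteq> ?K"
        unfolding Mh subset_iff split_paired_All kernel_compose by (auto simp: kernel_def)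
    qed
    then have "h x = h y" if "x \<in> carrier A" "y \<in> carrier A" "g (h x) = g (h y)" for x y
      using kernel_compose[of x y A g h] that unfolding Mh by (simp add: kernel_def)
    then show "inj_on g (carrier ?C)"
      by (auto intro!: inj_onI)
  qed
  then show ?thesis
    using hC hab by (rule that)
qed

section \<open>The equivalence\<close>

lemma generated_imp_covered:
  fixes P :: "('f, 'r, 'u) algebra set" and \<kappa> :: "'k rel"
  assumes U: "universe TYPE('u)" and P: "prevariety \<Omega> P" "residually_small \<Omega> P"
    and \<kappa>: "Card_order \<kappa>" and gen: "generated_by_at_most \<Omega> \<kappa> P"
  shows "irreducibles_covered \<Omega> \<kappa> P"
  unfolding irreducibles_covered_def
proof (intro allI impI)
  fix X :: "('f, 'r, 'u) algebra set"
  assume "small TYPE('u) X \<and> (\<forall>A\<in>X. subdirectly_irreducible \<Omega> P A)"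
  then have X: "small TYPE('u) X" "\<And>A. A \<in> X \<Longrightarrow> subdirectly_irreducible \<Omega> P A"
    by simp_all
  then have XP: "X \<subseteq> P"
    unfolding subdirectly_irreducible_def by blast
  obtain G where G: "G \<subseteq> Alg \<Omega>" "|G| \<le>o \<kappa>" and PG: "P = prevariety_generated \<Omega> G"
    using gen unfolding generated_by_at_most_def by blast
  have P_iff: "A \<in> P \<longleftrightarrow> A \<in> Alg \<Omega> \<and> separated \<Omega> G A" for A
    unfolding PG by (rule prevariety_generated_iff[OF U G(1)])
  have GP: "G \<subseteq> P"
    unfolding PG using U G(1) by (rule subset_prevariety_generated)
  have "|G| \<le>o |Field \<kappa>|"
    using G(2) card_of_Field_ordIso[OF \<kappa>] ordIso_symmetric ordLeq_ordIso_trans by blast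
  then obtain e where e: "inj_on e G" "e ` G \<subseteq> Field \<kappa>"
    using card_of_ordLeq[of G "Field \<kappa>"] by blast
  \<comment> \<open>\<open>e\<close> labels the generators by elements of
    \<open>Field \<kappa>\<close>, and a piece collects what embeds in the generator with its label.
    Pieces may overlap, and a label without a generator gives the empty piece.\<close>
  define Y where "Y \<alpha> = {A \<in> X. \<exists>B\<in>G. e B = \<alpha> \<and> (\<exists>h\<in>hom \<Omega> A B. inj_on h (carrier A))}" for \<alpha>
  have "X = (\<Union>\<alpha>\<in>Field \<kappa>. Y \<alpha>)"
  proof
    show "X \<subseteq> (\<Union>\<alpha>\<in>Field \<kappa>. Y \<alpha>)"
    proof
      fix A assume A: "A \<in> X"
      then have "separated \<Omega> G A"
        using XP P_iff by blast
      then obtain B h where "B \<in> G" "h \<in> hom \<Omega> A B" "inj_on h (carrier A)"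
        using subdirectly_irreducible_embeds[OF U P(1) GP X(2)[OF A]] by blast
      with A e(2) show "A \<in> (\<Union>\<alpha>\<in>Field \<kappa>. Y \<alpha>)"
        unfolding Y_def by blast
    qed
  qed (auto simp: Y_def)
  moreover have "compatible \<Omega> P (Y \<alpha>)" for \<alpha>
  proof (cases "Y \<alpha> = {}")
    case True
    \<comment> \<open>An empty piece need not come with a generator; its compatibility amounts to an
      initial algebra of \<open>P\<close>, the coproduct of the empty family.\<close>
    obtain C q where "is_coproduct \<Omega> P {} C q"
      using P(2) coproduct_exists[OF U, of _ \<Omega> P "{}"] small_subset[OF X(1), of "{}"]
      unfolding residually_small_def by blast
    then show ?thesis
      using True small_subset[OF X(1), of "{}"] unfolding compatible_def by auto
  next
    case False
    then obtain B where B: "B \<in> G" "e B = \<alpha>"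
      unfolding Y_def by blast
    show ?thesis
    proof (rule compatibleI[OF U P])
      show "Y \<alpha> \<subseteq> P" "small TYPE('u) (Y \<alpha>)" "B \<in> P"
        using XP small_subset[OF X(1)] B(1) GP unfolding Y_def by auto
      show "\<exists>h\<in>hom \<Omega> A B. inj_on h (carrier A)" if A: "A \<in> Y \<alpha>" for A
      proof -
        obtain B' where "B' \<in> G" "e B' = \<alpha>" "\<exists>h\<in>hom \<Omega> A B'. inj_on h (carrier A)"
          using A unfolding Y_def by blast
        moreover from this B have "B' = B"
          using inj_onD[OF e(1)] by blast
        ultimately show ?thesis
          by blast
      qed
    qed
  qed
  ultimately show "\<exists>Y :: 'k \<Rightarrow> ('f, 'r, 'u) algebra set.
      X = (\<Union>\<alpha>\<in>Field \<kappa>. Y \<alpha>) \<and> (\<forall>\<alpha>\<in>Field \<kappa>. compatible \<Omega> P (Y \<alpha>))"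
    by blast
qed

lemma covered_imp_generated:
  fixes P :: "('f, 'r, 'u) algebra set" and \<kappa> :: "'k rel"
  assumes U: "universe TYPE('u)" and P: "quasivariety \<Omega> P" "residually_small \<Omega> P"
    and \<kappa>: "Card_order \<kappa>" and cov: "irreducibles_covered \<Omega> \<kappa> P"
  shows "generated_by_at_most \<Omega> \<kappa> P"
proof -
  have P': "prevariety \<Omega> P"
    using P(1) unfolding quasivariety_def by simp
  obtain G where G: "G \<subseteq> Alg \<Omega>" "small TYPE('u) G" and PG: "P = prevariety_generated \<Omega> G"
    using P(2) unfolding residually_small_def by blast
  have P_iff: "A \<in> P \<longleftrightarrow> A \<in> Alg \<Omega> \<and> separated \<Omega> G A" for A
    unfolding PG by (rule prevariety_generated_iff[OF U G(1)])
  have GP: "G \<subseteq> P"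
    unfolding PG using U G(1) by (rule subset_prevariety_generated)
  \<comment> \<open>Representatives of all isomorphism types: a subdirectly irreducible algebra has
    a copy inside some \<open>B\<close> in \<open>G\<close>, and with the operations taken from
    \<open>B\<close> the copy is determined by \<open>B\<close> and its carrier
    \<open>S\<close>.\<close>
  define X where "X = {A. subdirectly_irreducible \<Omega> P A \<and> (\<exists>B\<in>G. \<exists>S\<subseteq>carrier B. A = mk_algebra \<Omega> S (oper B))}"
  have "small TYPE('u) (\<Union>B\<in>G. (\<lambda>S. mk_algebra \<Omega> S (oper B)) ` Pow (carrier B))"
    using prevariety_small[OF P'] GP by (intro small_UN[OF U G(2)] small_image small_Pow[OF U]) blast
  then have "small TYPE('u) X"
    by (rule small_subset) (auto simp: X_def)
  moreover have "\<forall>A\<in>X. subdirectly_irreducible \<Omega> P A"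
    unfolding X_def by blast
  ultimately obtain Y where Y: "X = (\<Union>\<alpha>\<in>Field \<kappa>. Y \<alpha>)"
    and Y_compatible: "\<And>\<alpha>. \<alpha> \<in> Field \<kappa> \<Longrightarrow> compatible \<Omega> P (Y \<alpha>)"
    using cov[unfolded irreducibles_covered_def, rule_format, of X] by auto
  \<comment> \<open>The choice depends on the piece \<open>Z\<close> and not on its index, so the
    chosen coproducts lie in the image of \<open>Pow X\<close> under \<open>C\<close>, which is
    small whatever the size of \<kappa>.\<close>
  define C where "C Z = (SOME C. \<exists>q. is_coproduct \<Omega> P Z C q \<and> (\<forall>A\<in>Z. inj_on (q A) (carrier A)))" for Z
  have C: "\<exists>q. is_coproduct \<Omega> P (Y \<alpha>) (C (Y \<alpha>)) q \<and> (\<forall>A\<in>Y \<alpha>. inj_on (q A) (carrier A))"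
    if "\<alpha> \<in> Field \<kappa>" for \<alpha>
    unfolding C_def
    by (rule someI_ex[OF Y_compatible[OF that, unfolded compatible_def, THEN conjunct2, THEN conjunct2]])
  let ?H = "(\<lambda>\<alpha>. C (Y \<alpha>)) ` Field \<kappa>"
  have HP: "?H \<subseteq> P"
    using C unfolding is_coproduct_def by auto
  have H_Alg: "?H \<subseteq> Alg \<Omega>"
    using HP P_iff by blast
  have "?H \<subseteq> C ` Pow X"
    using Y by blast
  then have "small TYPE('u) ?H"
    by (rule small_subset[OF small_image[OF small_Pow[OF U \<open>small TYPE('u) X\<close>]]])
  moreover have "|?H| \<le>o \<kappa>"
    using card_of_image card_of_Field_ordIso[OF \<kappa>] ordLeq_ordIso_trans by blast
  moreover have "P = prevariety_generated \<Omega> ?H"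
  proof (rule set_eqI)
    fix A :: "('f, 'r, 'u) algebra"
    have "separated \<Omega> P A" if "separated \<Omega> ?H A"
      using that HP unfolding separated_def by blast
    moreover have "separated \<Omega> ?H A" if A: "A \<in> P"
    proof (rule separatedI)
      fix a b assume ab: "a \<in> carrier A" "b \<in> carrier A" "a \<noteq> b"
      note A_alg = prevariety_is_algebra[OF P' A]
      obtain B h where B: "subdirectly_irreducible \<Omega> P B" and h: "h \<in> hom \<Omega> A B" "h a \<noteq> h b"
        using subdirectly_irreducible_separates[OF U P(1) A ab] .
      have BP: "B \<in> P"
        using B unfolding subdirectly_irreducible_def by blast
      note B_alg = prevariety_is_algebra[OF P' BP]
      obtain E k where E: "E \<in> G" and k: "k \<in> hom \<Omega> B E" "inj_on k (carrier B)"
        using subdirectly_irreducible_embeds[OF U P' GP B] BP P_iff by blast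
      let ?B = "image_algebra \<Omega> k B E"
      have k': "k \<in> iso \<Omega> B ?B"
        using B_alg k by (rule iso_image_algebra)
      have "subdirectly_irreducible \<Omega> P ?B"
        unfolding subdirectly_irreducible_def
      proof (intro conjI allI impI)
        show "?B \<in> P"
          using prevariety_image[OF U P' B_alg k(1)] E GP by blast
        fix I :: "'u set" and D Z
        assume D: "small TYPE('u) I \<and> (\<forall>i\<in>I. D i \<in> P) \<and> subdirect_product \<Omega> Z I D \<and> isomorphic \<Omega> ?B Z"
        then obtain l where "l \<in> iso \<Omega> ?B Z"
          unfolding isomorphic_def by blast
        then have "isomorphic \<Omega> B Z"
          using iso_compose[OF B_alg k'] unfolding isomorphic_def by blast
        with D show "\<exists>i\<in>I. (\<lambda>x\<in>carrier Z. x i) \<in> iso \<Omega> Z (D i)"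
          using B unfolding subdirectly_irreducible_def by blast
      qed
      moreover have "k ` carrier B \<subseteq> carrier E"
        using hom_mem[OF k(1)] by blast
      ultimately have "?B \<in> X"
        unfolding X_def using E by blast
      then obtain \<alpha> where \<alpha>: "\<alpha> \<in> Field \<kappa>" "?B \<in> Y \<alpha>"
        using Y by blast
      then obtain q where q: "q \<in> hom \<Omega> ?B (C (Y \<alpha>))" "inj_on q (carrier ?B)"
        using C[OF \<alpha>(1)] unfolding is_coproduct_def by blast
      \<comment> \<open>\<open>h\<close> keeps \<open>a\<close> and \<open>b\<close> apart, and the
        remaining maps, from \<open>B\<close> to its copy in \<open>E\<close> and on to the
        coproduct of the piece containing that copy, are injective.\<close>
      let ?g = "compose (carrier A) (compose (carrier B) q k) h"
      have "?g \<in> hom \<Omega> A (C (Y \<alpha>))"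
        by (rule hom_compose[OF A_alg h(1) hom_compose[OF B_alg iso_hom[OF k'] q(1)]])
      moreover have "?g a \<noteq> ?g b"
        using inj_on_eq_iff[OF inj_on_hom_compose[OF iso_hom[OF k'] k(2) q(2)]
            hom_mem[OF h(1) ab(1)] hom_mem[OF h(1) ab(2)]] h(2)
        unfolding compose_eq[OF ab(1)] compose_eq[OF ab(2)] by simp
      ultimately show "\<exists>B\<in>?H. \<exists>h\<in>hom \<Omega> A B. h a \<noteq> h b"
        using \<alpha>(1) by blast
    qed
    ultimately show "A \<in> P \<longleftrightarrow> A \<in> prevariety_generated \<Omega> ?H"
      unfolding prevariety_generated_iff[OF U H_Alg] using prevariety_iff[OF U P', of A] by blast
  qed
  ultimately show ?thesis
    using H_Alg unfolding generated_by_at_most_def by blast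
qed

theorem theorem21:
  fixes \<Omega> :: "('f, 'r) signature"
    and P :: "('f, 'r, 'u) algebra set"
    and \<kappa> :: "'k rel"
  assumes "universe TYPE('u)"
    and "small_signature TYPE('u) \<Omega>"
    and "prevariety \<Omega> P"
    and "residually_small \<Omega> P"
    and "Card_order \<kappa>"
  shows "(generated_by_at_most \<Omega> \<kappa> P \<longrightarrow> irreducibles_covered \<Omega> \<kappa> P) \<and>
         (quasivariety \<Omega> P \<longrightarrow>
            (generated_by_at_most \<Omega> \<kappa> P \<longleftrightarrow> irreducibles_covered \<Omega> \<kappa> P))"
  using generated_imp_covered[OF assms(1,3,4,5)] covered_imp_generated[OF assms(1) _ assms(4,5)]
  by blast

end
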